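(* Let $d\ge 1$ and $k$ be integers with $k>d/2$, and let $\mathcal{S}^{d-1}=\{x\in\mathbb{R}^d : |x|=1\}$. The set $\{\phi_{d,k}(|\cdot-y|) : y\in\mathcal{S}^{d-1}\}$ (of functions restricted to $\mathcal{S}^{d-1}$) is fundamental in $\mathbf{C}(\mathcal{S}^{d-1})$; that is, its linear span is dense in $\mathbf{C}(\mathcal{S}^{d-1})$ with respect to the uniform norm.
   Context: $|\cdot|$ is the Euclidean norm on $\mathbb{R}^d$ and $\mathbf{C}(\mathcal{S}^{d-1})$ is the space of real-valued continuous functions on $\mathcal{S}^{d-1}$ with the uniform norm. The polyharmonic spline $\phi_{d,k}:[0,\infty)\to\mathbb{R}$ (for integers $d\ge1$, $k>d/2$) is $\phi_{d,k}(r)=r^{2k-d}$ if $d$ is odd, and $\phi_{d,k}(r)=r^{2k-d}\log r$ if $d$ is even (with value $0$ at $r=0$). A set $A$ is fundamental in a normed vector space $X$ if for every $x\in X$ and $\epsilon>0$ there exist a finite subset $Y\subset A$ and coefficients $a_y$, $y\in Y$, such that $\|x-\sum_{y\in Y}a_y y\|<\epsilon$. *)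

theory Defs
  imports "HOL-Analysis.Analysis" "HOL-Real_Asymp.Real_Asymp"
begin

(* For r > 0 this is r^(2k-d), times log r when d is even.  The natural subtraction
   2 * k - d and the value 0 at r = 0 are as intended when k > d / 2. *)
definition polyharmonic_spline :: "nat \<Rightarrow> nat \<Rightarrow> real \<Rightarrow> real" where
  "polyharmonic_spline d k r =
     (if odd d then r ^ (2 * k - d)
      else if r = 0 then 0 else r ^ (2 * k - d) * ln r)"

definition fundamental :: "'a::real_normed_vector set \<Rightarrow> bool" where
  "fundamental A \<longleftrightarrow>
     (\<forall>x. \<forall>\<epsilon>>0. \<exists>Y a. finite Y \<and> Y \<subseteq> A \<and> norm (x - (\<Sum>y\<in>Y. a y *\<^sub>R y)) < \<epsilon>)"

lemma fundamental_iff_span_dense: "fundamental A \<longleftrightarrow> closure (span A) = UNIV"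
proof
  assume F: "fundamental A"
  have "x \<in> closure (span A)" for x
    unfolding closure_approachable
  proof (intro allI impI)
    fix e :: real assume e: "e > 0"
    obtain Y a where Y: "finite Y" "Y \<subseteq> A" "norm (x - (\<Sum>y\<in>Y. a y *\<^sub>R y)) < e"
      using F[unfolded fundamental_def, rule_format, OF e, of x] by (elim exE conjE)
    have "(\<Sum>y\<in>Y. a y *\<^sub>R y) \<in> span A"
      by (rule span_sum) (metis Y(2) span_base span_scale subsetD)
    moreover have "dist (\<Sum>y\<in>Y. a y *\<^sub>R y) x < e"
      using Y(3) by (metis dist_commute dist_norm)
    ultimately show "\<exists>y\<in>span A. dist y x < e" by (rule bexI[rotated])
  qed
  then show "closure (span A) = UNIV" by auto
next
  assume D: "closure (span A) = UNIV"
  show "fundamental A" unfolding fundamental_def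
  proof (intro allI impI)
    fix x :: 'a and e :: real assume "e > 0"
    moreover have "x \<in> closure (span A)" using D by simp
    ultimately obtain z where z: "z \<in> span A" "dist z x < e"
      unfolding closure_approachable by auto
    from z(1) obtain Y a where "finite Y" "Y \<subseteq> A" "z = (\<Sum>y\<in>Y. a y *\<^sub>R y)"
      unfolding span_explicit by auto
    moreover have "norm (x - z) < e"
      using z(2) by (metis dist_commute dist_norm)
    ultimately show "\<exists>Y a. finite Y \<and> Y \<subseteq> A \<and> norm (x - (\<Sum>y\<in>Y. a y *\<^sub>R y)) < e"
      by (intro exI[of _ Y] exI[of _ a]) simp
  qed
qed

(* The unit sphere of R^d, d = CARD('n), as a type with the Euclidean metric, so that
   the library's normed spaces of continuous functions apply to it. *)
typedef ('n::finite) unit_sphere = "sphere (0 :: real^'n) 1"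
  morphisms point_of unit_sphere_of
proof -
  obtain x :: "real^'n" where "norm x = 1"
    using vector_choose_size[of 1] by auto
  then show ?thesis by auto
qed

instantiation unit_sphere :: (finite) metric_space
begin

definition dist_unit_sphere :: "'a unit_sphere \<Rightarrow> 'a unit_sphere \<Rightarrow> real" where
  "dist_unit_sphere x y = dist (point_of x) (point_of y)"

definition uniformity_unit_sphere :: "('a unit_sphere \<times> 'a unit_sphere) filter" where
  "uniformity_unit_sphere = (INF e\<in>{0<..}. principal {(x, y). dist x y < e})"

definition open_unit_sphere :: "'a unit_sphere set \<Rightarrow> bool" where
  "open_unit_sphere U \<longleftrightarrow> (\<forall>x\<in>U. \<forall>\<^sub>F (x', y) in uniformity. x' = x \<longrightarrow> y \<in> U)"

instance
proof
  fix x y z :: "'a unit_sphere"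
  show "(dist x y = 0) = (x = y)"
    by (simp add: dist_unit_sphere_def point_of_inject)
  show "dist x y \<le> dist x z + dist y z"
    by (simp add: dist_unit_sphere_def dist_triangle2)
qed (simp_all add: uniformity_unit_sphere_def open_unit_sphere_def)

end

lemma continuous_on_point_of: "continuous_on UNIV point_of"
  unfolding continuous_on_iff by (auto simp: dist_unit_sphere_def)

lemma continuous_on_unit_sphere_of: "continuous_on (sphere 0 1) unit_sphere_of"
  unfolding continuous_on_iff
  by (auto simp: dist_unit_sphere_def unit_sphere_of_inverse)

(* By compactness, every real-valued continuous function on the sphere is bounded, so the
   type of bounded continuous functions, whose norm is the supremum norm, is C(S^(d-1)). *)
lemma compact_UNIV_unit_sphere: "compact (UNIV :: ('n::finite) unit_sphere set)"
proof -
  have "unit_sphere_of ` sphere (0 :: real^'n) 1 = UNIV"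
    using type_definition.Abs_image[OF type_definition_unit_sphere] .
  then show ?thesis
    using compact_continuous_image[OF continuous_on_unit_sphere_of compact_sphere] by metis
qed

lemma continuous_imp_mem_bcontfun:
  fixes f :: "('n::finite) unit_sphere \<Rightarrow> real"
  assumes "continuous_on UNIV f"
  shows "f \<in> bcontfun"
  using assms compact_imp_bounded[OF compact_continuous_image[OF assms compact_UNIV_unit_sphere]]
  by (simp add: bcontfun_def)

lemma norm_bcontfun_eq_SUP:
  fixes f :: "('n::finite) unit_sphere \<Rightarrow>\<^sub>C real"
  shows "norm f = (SUP x. \<bar>apply_bcontfun f x\<bar>)"
  unfolding norm_bcontfun_def dist_bcontfun_def by (simp add: dist_real_def)

definition spline_translates :: "nat \<Rightarrow> (('n::finite) unit_sphere \<Rightarrow>\<^sub>C real) set" where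
  "spline_translates k =
     {f. \<exists>y. \<forall>x. apply_bcontfun f x =
           polyharmonic_spline CARD('n) k (norm (point_of x - point_of y))}"

lemma continuous_on_polyharmonic_spline:
  assumes "real k > real d / 2"
  shows "continuous_on {0..} (polyharmonic_spline d k)"
proof (cases "odd d")
  case True
  then have "polyharmonic_spline d k = (\<lambda>r. r ^ (2 * k - d))"
    by (auto simp: polyharmonic_spline_def)
  then show ?thesis by (simp add: continuous_on_power continuous_on_id)
next
  case False
  obtain m where m: "2 * k - d = Suc m"
    using assms by (cases "2 * k - d") auto
  have eq: "polyharmonic_spline d k r = r ^ m * (r * ln r)" for r
    using False m by (auto simp: polyharmonic_spline_def)
  have "continuous_on {0..} (\<lambda>r::real. r * ln r)"
    unfolding continuous_on_eq_continuous_within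
  proof
    fix x :: real assume "x \<in> {0..}"
    show "continuous (at x within {0..}) (\<lambda>r. r * ln r)"
    proof (cases "x = 0")
      case True
      have "((\<lambda>r::real. r * ln r) \<longlongrightarrow> 0) (at_right 0)"
        by real_asymp
      moreover have "at (0::real) within {0..} = at_right 0"
      proof -
        have "{0..} - {0} = {(0::real)<..} - {0}" by auto
        then show ?thesis by (simp only: at_within_def)
      qed
      ultimately show ?thesis using True by (simp add: continuous_within)
    next
      case False
      show ?thesis
        by (rule continuous_at_imp_continuous_at_within
                   [OF continuous_mult[OF continuous_ident isCont_ln[OF False]]])
    qed
  qed
  from continuous_on_mult[OF continuous_on_power[OF continuous_on_id] this]
  have "continuous_on {0..} (\<lambda>r::real. r ^ m * (r * ln r))"
    .
  moreover have "polyharmonic_spline d k = (\<lambda>r. r ^ m * (r * ln r))"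
    using eq by (rule ext)
  ultimately show ?thesis by simp
qed

(* Every spline centre does contribute an element of spline_translates. *)
lemma ex_spline_translate:
  fixes y :: "('n::finite) unit_sphere"
  assumes "real k > real CARD('n) / 2"
  shows "\<exists>f \<in> spline_translates k. \<forall>x. apply_bcontfun f x =
           polyharmonic_spline CARD('n) k (norm (point_of x - point_of y))"
proof -
  let ?g = "\<lambda>x. polyharmonic_spline CARD('n) k (norm (point_of x - point_of y))"
  have "continuous_on UNIV ?g"
    by (rule continuous_on_compose2[OF continuous_on_polyharmonic_spline[OF assms]
          continuous_on_norm[OF continuous_on_diff[OF continuous_on_point_of continuous_on_const]]])
       auto
  then have "apply_bcontfun (Bcontfun ?g) = ?g"
    by (rule Bcontfun_inverse[OF continuous_imp_mem_bcontfun])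
  then have g: "\<forall>x. apply_bcontfun (Bcontfun ?g) x = ?g x"
    by (rule fun_cong[THEN allI])
  then have "Bcontfun ?g \<in> spline_translates k"
    unfolding spline_translates_def by blast
  from g this show ?thesis by (rule bexI)
qed

end

theory Submission
  imports Defs
begin

text \<open>
  On the unit sphere \<open>norm (x - y) = sqrt (2 - 2 * (x \<bullet> y))\<close>, so a spline translate is the zonal function
  \<open>x \<mapsto> f (x \<bullet> y)\<close> with \<open>f t\<close> a multiple of \<open>(1 - t)\<^sup>s\<close> or of \<open>(1 - t)\<^sup>s * ln (2 - 2 * t)\<close>, where
  \<open>s = k - d / 2\<close>. Its Taylor series \<open>\<Sum>n. a n * t ^ n\<close> converges absolutely on \<open>[-1, 1]\<close>, and the
  coefficients have one strict sign from some index \<open>M\<close> on. Let \<open>V\<close> be the closed span of the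
  translates.

  If all coefficients are positive, \<open>(x, y) \<mapsto> f (x \<bullet> y)\<close> is a positive definite kernel whose feature space
  contains every tensor power \<open>z\<^sup>\<otimes>\<^sup>n\<close>. Approximating such a tensor by combinations of kernel sections in
  the kernel's quadratic form also approximates the function \<open>x \<mapsto> (x \<bullet> z) ^ n\<close> uniformly; exponentials
  of linear forms and Stone--Weierstrass then give density (\<open>positive_zonal_span_dense\<close>). In general,
  after division by the common sign, only the terms of degree below \<open>M\<close> have to be changed to reach
  this situation, so \<open>V\<close> together with the finite-dimensional space of zonal polynomials of degree below \<open>M\<close> spans everything.

  To remove these extra polynomials, use that \<open>V\<close> is closed and rotation invariant. Second differences
  along rotations show that \<open>V\<close> is closed under the Laplacian of the sphere as far as it acts on
  polynomials. The zonal eigenfunctions of the Laplacian are the Gegenbauer polynomials \<open>G l\<close>, with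
  distinct eigenvalues if \<open>d \<ge> 2\<close>. Applying \<open>Laplacian + eigenvalue\<close> for the degrees below \<open>M\<close> shows that \<open>G l\<close>
  lies in \<open>V\<close> for \<open>l \<ge> M\<close>. Hence the part of degree below \<open>M\<close> of the Gegenbauer expansion of \<open>f\<close> lies in
  \<open>V\<close>, and by distinctness of the eigenvalues each \<open>G l\<close> that occurs in it with a nonzero coefficient does. This
  is \<open>zonal_span_dense_criterion\<close>: density holds once the first \<open>M\<close> Gegenbauer coefficients do not vanish.

  Up to a positive factor, the coefficient of \<open>G l\<close> is the mean of the \<open>l\<close>-th derivative of \<open>f\<close>, taken at the first
  coordinate of a point, over the unit sphere of \<open>(d + 2 * l)\<close>-dimensional space. A derivative of \<open>(1 - t)\<^sup>s\<close> is a
  multiple of a power again. One of \<open>(1 - t)\<^sup>s * ln (2 - 2 * t)\<close> is a multiple of \<open>(1 - t)\<^sup>i * (ln (2 - 2 * t) + r)\<close> with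
  \<open>r \<ge> 0\<close>. The divergence theorem gives a recurrence in the exponent for the means of such functions; it preserves
  positivity, and the means for the smallest exponents are estimated by hand. Dimension \<open>d = 1\<close> is a
  two-point space and is treated directly.
\<close>

section \<open>Ridge and zonal functions on the sphere\<close>

definition ridge :: "(real \<Rightarrow> real) \<Rightarrow> real^'n \<Rightarrow> ('n::finite unit_sphere \<Rightarrow>\<^sub>C real)" where
  "ridge g z = Bcontfun (\<lambda>x. g (point_of x \<bullet> z))"

lemma norm_point_of [simp]: "norm (point_of x) = 1"
  using point_of[of x] by simp

lemma abs_inner_point_of_le: "\<bar>point_of x \<bullet> z\<bar> \<le> norm z"
  using Cauchy_Schwarz_ineq2[of "point_of x" z] by simp

lemma apply_ridge [simp]:
  assumes "continuous_on UNIV g"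
  shows "apply_bcontfun (ridge g z) x = g (point_of x \<bullet> z)"
proof -
  have "continuous_on UNIV (\<lambda>x. point_of x \<bullet> z)"
    by (intro continuous_on_inner continuous_on_point_of continuous_on_const)
  then have "continuous_on UNIV (\<lambda>x. g (point_of x \<bullet> z))"
    using continuous_on_compose2[OF assms] by auto
  from Bcontfun_inverse[OF continuous_imp_mem_bcontfun[OF this]]
  show ?thesis unfolding ridge_def by simp
qed

lemma continuous_on_poly_fun: "continuous_on A (poly p)" for p :: "real poly"
  by (intro continuous_intros)

definition ridge_poly :: "real poly \<Rightarrow> real^'n \<Rightarrow> ('n::finite unit_sphere \<Rightarrow>\<^sub>C real)" where
  "ridge_poly p = ridge (poly p)"

lemma apply_ridge_poly [simp]: "apply_bcontfun (ridge_poly p z) x = poly p (point_of x \<bullet> z)"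
  unfolding ridge_poly_def by (rule apply_ridge) (rule continuous_on_poly_fun)

lemma ridge_poly_add: "ridge_poly (p + q) z = ridge_poly p z + ridge_poly q z"
  and ridge_poly_smult: "ridge_poly (smult c p) z = c *\<^sub>R ridge_poly p z"
  and ridge_poly_0: "ridge_poly 0 z = 0"
  by (auto intro!: bcontfun_eqI)

lemma ridge_poly_sum: "ridge_poly (\<Sum>i\<in>I. p i) z = (\<Sum>i\<in>I. ridge_poly (p i) z)"
  by (induction I rule: infinite_finite_induct) (auto simp: ridge_poly_0 ridge_poly_add)

abbreviation ridge_power :: "nat \<Rightarrow> real^'n \<Rightarrow> ('n::finite unit_sphere \<Rightarrow>\<^sub>C real)" where
  "ridge_power n \<equiv> ridge_poly (monom 1 n)"

lemma apply_ridge_power: "apply_bcontfun (ridge_power n z) x = (point_of x \<bullet> z) ^ n"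
  by (simp add: poly_monom)

lemma norm_ridge_power_le: "norm (ridge_power n z) \<le> norm z ^ n"
proof (rule norm_bound)
  fix x :: "'a unit_sphere"
  show "norm (apply_bcontfun (ridge_power n z) x) \<le> norm z ^ n"
    unfolding apply_ridge_power using abs_inner_point_of_le[of x z]
    by (simp add: power_abs power_mono)
qed

instance bcontfun :: (metric_space, banach) banach ..

lemma summable_ridge_powers:
  assumes "summable (\<lambda>n. \<bar>a n\<bar> * norm z ^ n)"
  shows "summable (\<lambda>n. a n *\<^sub>R ridge_power n z)"
proof (rule summable_norm_cancel, rule summable_comparison_test')
  show "norm (norm (a n *\<^sub>R ridge_power n z)) \<le> \<bar>a n\<bar> * norm z ^ n" for n
    using norm_ridge_power_le[of n z] by (simp add: mult_left_mono)
qed (rule assms)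

lemma bounded_linear_apply_bcontfun: "bounded_linear (\<lambda>f. apply_bcontfun f x)"
  for x :: "'a::topological_space" 
proof
  show "\<exists>K. \<forall>f. norm (apply_bcontfun f x) \<le> norm f * K" for x
    using norm_bounded by (metis mult.right_neutral)
qed auto

lemma sums_ridge_powers_apply:
  assumes "summable (\<lambda>n. \<bar>a n\<bar> * norm z ^ n)"
  shows "(\<lambda>n. a n * (point_of x \<bullet> z) ^ n) sums apply_bcontfun (\<Sum>n. a n *\<^sub>R ridge_power n z) x"
  using bounded_linear.sums[OF bounded_linear_apply_bcontfun summable_sums[OF summable_ridge_powers[OF assms]], of x]
  by (simp add: poly_monom)

text \<open>
  The restriction to the sphere of \<open>x \<mapsto> f (x \<bullet> y)\<close> for the power series \<open>f t = (\<Sum>n. a n * t ^ n)\<close>, summed in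
  the Banach space of continuous functions, so that uniform convergence comes for free.
\<close>
definition zonal :: "(nat \<Rightarrow> real) \<Rightarrow> 'n::finite unit_sphere \<Rightarrow> ('n unit_sphere \<Rightarrow>\<^sub>C real)" where
  "zonal a y = (\<Sum>n. a n *\<^sub>R ridge_power n (point_of y))"

lemma sums_zonal:
  assumes "summable (\<lambda>n. \<bar>a n\<bar>)"
  shows "(\<lambda>n. a n *\<^sub>R ridge_power n (point_of y)) sums zonal a y"
  unfolding zonal_def by (intro summable_sums summable_ridge_powers) (simp add: assms)

lemma sums_zonal_apply:
  assumes "summable (\<lambda>n. \<bar>a n\<bar>)"
  shows "(\<lambda>n. a n * (point_of x \<bullet> point_of y) ^ n) sums apply_bcontfun (zonal a y) x"
  unfolding zonal_def by (intro sums_ridge_powers_apply) (simp add: assms)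

lemma subspace_closure_span: "subspace (closure (span A))" for A :: "'a::real_normed_vector set"
proof (rule subspaceI)
  show "0 \<in> closure (span A)" using closure_subset span_zero by blast
next
  fix x y assume "x \<in> closure (span A)" "y \<in> closure (span A)"
  then obtain f g where "\<And>n. f n \<in> span A" "f \<longlonglongrightarrow> x" "\<And>n. g n \<in> span A" "g \<longlonglongrightarrow> y"
    unfolding closure_sequential by blast
  then show "x + y \<in> closure (span A)"
    unfolding closure_sequential by (intro exI[of _ "\<lambda>n. f n + g n"]) (auto intro: span_add tendsto_add)
next
  fix c x assume "x \<in> closure (span A)"
  then obtain f where "\<And>n. f n \<in> span A" "f \<longlonglongrightarrow> x"
    unfolding closure_sequential by blast
  then show "c *\<^sub>R x \<in> closure (span A)"
    unfolding closure_sequential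
    by (intro exI[of _ "\<lambda>n. c *\<^sub>R f n"]) (auto intro: span_scale tendsto_intros)
qed

lemma closed_sums_mem:
  assumes "closed V" "subspace V" "\<And>n. f n \<in> V" "f sums s"
  shows "s \<in> V"
proof (rule closed_sequentially[OF assms(1)])
  show "(\<lambda>n. sum f {..<n}) \<longlonglongrightarrow> s" using assms(4) by (simp add: sums_def)
  show "sum f {..<n} \<in> V" for n using assms(2,3) by (intro subspace_sum) auto
qed

section \<open>Zonal kernels with positive Taylor coefficients\<close>

text \<open>
  This replaces the orthogonal projection onto the span of the kernel sections in the feature space of
  \<open>K\<close>. The lists encode finite combinations of sections; \<open>u\<close> is the function represented by a vector of
  squared norm \<open>w\<close>, and \<open>psd\<close> says that the squared distance from this vector to a combination is
  nonnegative. If a combination comes within \<open>e\<^sup>2 / C\<close> of the infimum, then adding one more section at \<open>x\<close>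
  cannot improve it by more, which bounds the residual at every point \<open>x\<close>. A near-minimiser suffices, so
  that completeness of the feature space is not an issue.
\<close>
lemma kernel_near_minimiser:
  fixes K :: "'x \<Rightarrow> 'x \<Rightarrow> real" and u :: "'x \<Rightarrow> real"
  assumes sym: "\<And>x y. K x y = K y x"
    and bound: "\<And>x. K x x \<le> C" and C: "C > 0"
    and psd: "\<And>xs. 0 \<le> w - 2 * (\<Sum>(c, y)\<leftarrow>xs. c * u y)
                     + (\<Sum>(c, y)\<leftarrow>xs. c * (\<Sum>(b, x)\<leftarrow>xs. b * K y x))"
    and e: "e > 0"
  shows "\<exists>xs. \<forall>x. \<bar>u x - (\<Sum>(c, y)\<leftarrow>xs. c * K x y)\<bar> \<le> e"
proof -
  define Q where "Q xs = w - 2 * (\<Sum>(c, y)\<leftarrow>xs. c * u y)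
                     + (\<Sum>(c, y)\<leftarrow>xs. c * (\<Sum>(b, x)\<leftarrow>xs. b * K y x))" for xs
  define \<delta> where "\<delta> = e\<^sup>2 / C"
  have \<delta>: "\<delta> > 0" using e C by (simp add: \<delta>_def)
  have bdd: "bdd_below (range Q)" using psd by (intro bdd_belowI[of _ 0]) (auto simp: Q_def)
  obtain xs where "Q xs < (INF xs. Q xs) + \<delta>"
    using cInf_lessD[of "range Q" "(INF xs. Q xs) + \<delta>"] \<delta> by auto
  then have near: "Q xs < Q ys + \<delta>" for ys
    using cINF_lower[OF bdd, of ys] by (auto intro: less_le_trans)
  show ?thesis
  proof (intro exI[of _ xs] allI)
    fix x
    define d where "d = u x - (\<Sum>(c, y)\<leftarrow>xs. c * K x y)"
    \<comment> \<open>minimises the upper bound for the quadratic form along the section at \<open>x\<close>\<close>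
    define t where "t = d / C"
    have split: "(\<Sum>(c, y)\<leftarrow>xs. c * (t * K y x + (\<Sum>(b, x')\<leftarrow>xs. b * K y x')))
       = t * (\<Sum>(c, y)\<leftarrow>xs. c * K x y) + (\<Sum>(c, y)\<leftarrow>xs. c * (\<Sum>(b, x')\<leftarrow>xs. b * K y x'))"
    proof -
      have "(\<Sum>(c, y)\<leftarrow>zs. c * (t * K y x + (\<Sum>(b, x')\<leftarrow>xs. b * K y x')))
        = t * (\<Sum>(c, y)\<leftarrow>zs. c * K x y) + (\<Sum>(c, y)\<leftarrow>zs. c * (\<Sum>(b, x')\<leftarrow>xs. b * K y x'))" for zs
        by (induction zs) (auto simp: algebra_simps sym[of _ x])
      then show ?thesis .
    qed
    have "Q ((t, x) # xs) = Q xs - 2 * t * d + t\<^sup>2 * K x x"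
      unfolding Q_def d_def using split
      by (simp add: algebra_simps power2_eq_square)
    also have "\<dots> \<le> Q xs - 2 * t * d + t\<^sup>2 * C"
      using bound[of x] by (simp add: mult_left_mono)
    also have "\<dots> = Q xs - d\<^sup>2 / C"
      using C by (simp add: t_def power2_eq_square)
    finally have "d\<^sup>2 / C \<le> e\<^sup>2 / C" using near[of "(t, x) # xs"] unfolding \<delta>_def by linarith
    then have "d\<^sup>2 \<le> e\<^sup>2" using C by (simp add: divide_le_cancel)
    then show "\<bar>u x - (\<Sum>(c, y)\<leftarrow>xs. c * K x y)\<bar> \<le> e"
      using e unfolding d_def by (metis abs_le_square_iff abs_of_pos)
  qed
qed

text \<open>
  The \<open>n\<close>-th power of the inner product is the inner product of tensor powers. Splitting off one tensor
  factor along an orthonormal basis, and absorbing its coordinates into the coefficients, gives an induction that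
  needs no tensors.
\<close>
lemma power_inner_psd:
  fixes xs :: "(real \<times> 'a::euclidean_space) list"
  shows "0 \<le> (\<Sum>(c, y)\<leftarrow>xs. c * (\<Sum>(b, x)\<leftarrow>xs. b * (y \<bullet> x) ^ n))"
proof (induction n arbitrary: xs)
  case 0
  have "(\<Sum>(c, y)\<leftarrow>ys. c * (\<Sum>(b, x)\<leftarrow>xs. b * (y \<bullet> x) ^ 0))
    = (\<Sum>(c, y)\<leftarrow>ys. c) * (\<Sum>(c, y)\<leftarrow>xs. c)" for ys
    by (induction ys) (auto simp: algebra_simps)
  then show ?case by simp
next
  case (Suc n)
  define f where "f e = (\<lambda>(c, y). (c * (y \<bullet> e), y :: 'a))" for e
  have inner: "(\<Sum>(b, x)\<leftarrow>zs. b * (y \<bullet> x) ^ Suc n)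
      = (\<Sum>e\<in>Basis. (y \<bullet> e) * (\<Sum>(b, x)\<leftarrow>map (f e) zs. b * (y \<bullet> x) ^ n))" for y zs
  proof (induction zs)
    case (Cons p zs)
    obtain b x where p: "p = (b, x)" by (cases p)
    have "b * (y \<bullet> x) ^ Suc n = (\<Sum>e\<in>Basis. (y \<bullet> e) * (b * (x \<bullet> e) * (y \<bullet> x) ^ n))"
      by (subst power_Suc, subst euclidean_inner) (simp add: sum_distrib_left sum_distrib_right mult_ac)
    then show ?case using Cons by (simp add: p f_def sum.distrib algebra_simps)
  qed auto
  have "(\<Sum>(c, y)\<leftarrow>ys. c * (\<Sum>(b, x)\<leftarrow>xs. b * (y \<bullet> x) ^ Suc n))
     = (\<Sum>e\<in>Basis. \<Sum>(c, y)\<leftarrow>map (f e) ys. c * (\<Sum>(b, x)\<leftarrow>map (f e) xs. b * (y \<bullet> x) ^ n))" for ys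
  proof (induction ys)
    case (Cons p ys)
    obtain c y where p: "p = (c, y)" by (cases p)
    show ?case using Cons inner[of y xs]
      by (simp add: p f_def sum.distrib sum_distrib_left mult.assoc)
  qed auto
  then show ?case using Suc by (simp only: sum_nonneg)
qed

lemma sums_sum_list:
  fixes f :: "nat \<Rightarrow> 'b \<Rightarrow> real"
  assumes "\<And>x. x \<in> set xs \<Longrightarrow> (\<lambda>n. f n x) sums g x"
  shows "(\<lambda>n. \<Sum>x\<leftarrow>xs. f n x) sums (\<Sum>x\<leftarrow>xs. g x)"
  using assms by (induction xs) (auto intro!: sums_add)

text \<open>
  The function \<open>x \<mapsto> (x \<bullet> z) ^ n\<close> is represented in the feature space of the kernel by the \<open>n\<close>-th tensor
  power of \<open>z\<close>, whose squared norm there is \<open>(z \<bullet> z) ^ n / a n\<close>; this is where \<open>a n > 0\<close> is needed. Only the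
  degree-\<open>n\<close> level of the quadratic form interacts with it, so positivity of that level suffices.
\<close>
lemma ridge_power_mem_positive_zonal_span:
  fixes z :: "real^'n"
  assumes sum: "summable a" and pos: "\<And>n. a n > 0"
  shows "ridge_power n z \<in> closure (span (range (zonal a)))"
proof -
  have abs: "\<bar>a n\<bar> = a n" for n using pos[of n] by simp
  define K where "K x y = apply_bcontfun (zonal a y) x" for x y :: "'n unit_sphere"
  have sumsK: "(\<lambda>k. a k * (point_of x \<bullet> point_of y) ^ k) sums K x y" for x y
    unfolding K_def by (rule sums_zonal_apply) (simp add: abs sum)
  have sym: "K x y = K y x" for x y
    using sumsK[of x y] sumsK[of y x] by (simp add: inner_commute sums_unique2)
  have diag: "K x x \<le> suminf a" for x
    using sumsK[of x x] by (simp add: dot_square_norm sums_iff)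
  have C: "suminf a > 0" by (rule suminf_pos[OF sum pos])
  define u where "u x = (point_of x \<bullet> z) ^ n" for x :: "'n unit_sphere"
  have psd: "0 \<le> (z \<bullet> z) ^ n / a n - 2 * (\<Sum>(c, y)\<leftarrow>xs. c * u y)
        + (\<Sum>(c, y)\<leftarrow>xs. c * (\<Sum>(b, x)\<leftarrow>xs. b * K y x))" for xs
  proof -
    define ps where "ps = map (\<lambda>(c, y :: 'n unit_sphere). (c, point_of y)) xs"
    define q where "q k = (\<Sum>(c, y)\<leftarrow>xs. c * (\<Sum>(b, x)\<leftarrow>xs. b * (point_of y \<bullet> point_of x) ^ k))" for k
    have q: "q k = (\<Sum>(c, y)\<leftarrow>ps. c * (\<Sum>(b, x)\<leftarrow>ps. b * (y \<bullet> x) ^ k))" for k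
      unfolding q_def ps_def by (simp add: case_prod_unfold comp_def)
    have q0: "q k \<ge> 0" for k unfolding q by (rule power_inner_psd)
    have "(\<lambda>k. \<Sum>(c, y)\<leftarrow>xs. c * (\<Sum>(b, x)\<leftarrow>xs. b * (a k * (point_of y \<bullet> point_of x) ^ k)))
        sums (\<Sum>(c, y)\<leftarrow>xs. c * (\<Sum>(b, x)\<leftarrow>xs. b * K y x))"
      unfolding case_prod_unfold by (intro sums_sum_list sums_mult sumsK)
    moreover have "(\<Sum>(c, y)\<leftarrow>xs. c * (\<Sum>(b, x)\<leftarrow>xs. b * (a k * (point_of y \<bullet> point_of x) ^ k))) = a k * q k" for k
      unfolding q_def case_prod_unfold sum_list_const_mult[symmetric]
      by (simp add: mult.left_commute)
    ultimately have s: "(\<lambda>k. a k * q k) sums (\<Sum>(c, y)\<leftarrow>xs. c * (\<Sum>(b, x)\<leftarrow>xs. b * K y x))" by simp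
    have "(\<Sum>k\<in>{n}. a k * q k) \<le> (\<Sum>k. a k * q k)"
      using s q0 pos by (intro sum_le_suminf) (auto simp: sums_iff less_imp_le)
    also have "\<dots> = (\<Sum>(c, y)\<leftarrow>xs. c * (\<Sum>(b, x)\<leftarrow>xs. b * K y x))"
      using s by (simp add: sums_iff)
    finally have 1: "a n * q n \<le> (\<Sum>(c, y)\<leftarrow>xs. c * (\<Sum>(b, x)\<leftarrow>xs. b * K y x))" by simp
    \<comment> \<open>complete the square on level \<open>n\<close>: append the target point \<open>z\<close> with weight \<open>-1 / a n\<close>\<close>
    have "0 \<le> a n * (\<Sum>(c, y)\<leftarrow>(-1 / a n, z) # ps. c * (\<Sum>(b, x)\<leftarrow>(-1 / a n, z) # ps. b * (y \<bullet> x) ^ n))"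
      by (intro mult_nonneg_nonneg power_inner_psd less_imp_le pos)
    also have "\<dots> = (z \<bullet> z) ^ n / a n - 2 * (\<Sum>(c, y)\<leftarrow>ps. c * (y \<bullet> z) ^ n) + a n * q n"
    proof -
      have A: "(\<Sum>(b, x)\<leftarrow>ps. b * (z \<bullet> x) ^ n) = (\<Sum>(c, y)\<leftarrow>ps. c * (y \<bullet> z) ^ n)"
        by (simp add: inner_commute)
      have B: "(\<Sum>(c, y)\<leftarrow>rs. c * (r * (y \<bullet> z) ^ n + (\<Sum>(b, x)\<leftarrow>ps. b * (y \<bullet> x) ^ n)))
        = r * (\<Sum>(c, y)\<leftarrow>rs. c * (y \<bullet> z) ^ n) + (\<Sum>(c, y)\<leftarrow>rs. c * (\<Sum>(b, x)\<leftarrow>ps. b * (y \<bullet> x) ^ n))" for rs r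
        by (induction rs) (auto simp: algebra_simps)
      have "(\<Sum>(c, y)\<leftarrow>(r, z) # ps. c * (\<Sum>(b, x)\<leftarrow>(r, z) # ps. b * (y \<bullet> x) ^ n))
          = r * (r * (z \<bullet> z) ^ n + (\<Sum>(c, y)\<leftarrow>ps. c * (y \<bullet> z) ^ n))
            + (r * (\<Sum>(c, y)\<leftarrow>ps. c * (y \<bullet> z) ^ n) + q n)" for r
        using B[of r ps] by (simp add: A q)
      then show ?thesis using pos[of n] by (simp only:) (simp add: field_simps)
    qed
    also have "(\<Sum>(c, y)\<leftarrow>ps. c * (y \<bullet> z) ^ n) = (\<Sum>(c, y)\<leftarrow>xs. c * u y)"
      unfolding ps_def u_def by (simp add: case_prod_unfold comp_def)
    finally show ?thesis using 1 by linarith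
  qed
  show ?thesis unfolding closure_approachable
  proof (intro allI impI)
    fix e :: real assume "e > 0"
    then obtain xs where xs: "\<And>x. \<bar>u x - (\<Sum>(c, y)\<leftarrow>xs. c * K x y)\<bar> \<le> e / 2"
      using kernel_near_minimiser[of K "suminf a" _ u "e / 2", OF sym diag C psd] by auto
    define v where "v = (\<Sum>(c, y)\<leftarrow>xs. c *\<^sub>R zonal a y)"
    have "(\<Sum>(c, y)\<leftarrow>ys. c *\<^sub>R zonal a y) \<in> span (range (zonal a))" for ys
      by (induction ys) (auto intro!: span_add[OF span_scale[OF span_base]] span_zero)
    then have "v \<in> span (range (zonal a))" by (simp add: v_def)
    moreover have "apply_bcontfun (\<Sum>(c, y)\<leftarrow>ys. c *\<^sub>R zonal a y) x = (\<Sum>(c, y)\<leftarrow>ys. c * K x y)" for x ys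
      by (induction ys) (auto simp: K_def)
    then have "dist v (ridge_power n z) \<le> e / 2"
      using xs by (intro dist_bound) (simp add: v_def poly_monom u_def dist_real_def abs_minus_commute)
    ultimately show "\<exists>v\<in>span (range (zonal a)). dist v (ridge_power n z) < e"
      using \<open>e > 0\<close> by (intro bexI[of _ v]) auto
  qed
qed

text \<open>
  Exponentials of linear forms are closed under products, so their span is an algebra and
  Stone--Weierstrass applies to it.
\<close>
lemma span_ridge_exp_dense: "closure (span (range (ridge exp))) = (UNIV :: ('n::finite unit_sphere \<Rightarrow>\<^sub>C real) set)"
proof -
  let ?E = "span (range (ridge exp :: real^'n \<Rightarrow> _))"
  have cexp: "continuous_on UNIV (exp :: real \<Rightarrow> real)" by (intro continuous_intros)
  have prod: "\<exists>w\<in>?E. \<forall>x. apply_bcontfun w x = apply_bcontfun u x * apply_bcontfun v x"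
    if "u \<in> ?E" "v \<in> ?E" for u v
    using that(1)
  proof (induction u rule: span_induct_alt)
    case base
    then show ?case by (intro bexI[of _ 0]) (auto simp: span_zero)
  next
    case (step c f u)
    obtain z where f: "f = ridge exp z" using step by auto
    have "\<exists>w\<in>?E. \<forall>x. apply_bcontfun w x = apply_bcontfun f x * apply_bcontfun v x"
      using that(2)
    proof (induction v rule: span_induct_alt)
      case base
      then show ?case by (intro bexI[of _ 0]) (auto simp: span_zero)
    next
      case (step b g v)
      obtain z' where g: "g = ridge exp z'" using step by auto
      obtain w where w: "w \<in> ?E" "\<forall>x. apply_bcontfun w x = apply_bcontfun f x * apply_bcontfun v x"
        using step by auto
      show ?case
        using w(2) by (intro bexI[of _ "b *\<^sub>R ridge exp (z + z') + w"])
          (auto simp: f g cexp inner_add_right exp_add algebra_simps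
             intro!: w(1) span_add[OF span_scale[OF span_base]] span_add[OF w(1) span_scale[OF span_base]])
    qed
    then obtain w1 where w1: "w1 \<in> ?E" "\<forall>x. apply_bcontfun w1 x = apply_bcontfun f x * apply_bcontfun v x"
      by blast
    obtain w where w: "w \<in> ?E" "\<forall>x. apply_bcontfun w x = apply_bcontfun u x * apply_bcontfun v x"
      using step by auto
    show ?case using w(2) w1(2)
      by (intro bexI[of _ "c *\<^sub>R w1 + w"]) (auto simp: algebra_simps intro!: span_add span_scale w w1(1))
  qed
  interpret F: function_ring_on "apply_bcontfun ` ?E" "UNIV :: 'n unit_sphere set"
  proof
    show "compact (UNIV :: 'n unit_sphere set)" by (rule compact_UNIV_unit_sphere)
  next
    fix f assume "f \<in> apply_bcontfun ` ?E"
    then show "continuous_on UNIV f" by auto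
  next
    fix f g assume "f \<in> apply_bcontfun ` ?E" "g \<in> apply_bcontfun ` ?E"
    then obtain u v where uv: "u \<in> ?E" "v \<in> ?E" "f = apply_bcontfun u" "g = apply_bcontfun v" by auto
    show "(\<lambda>x. f x + g x) \<in> apply_bcontfun ` ?E"
      using uv by (intro image_eqI[of _ _ "u + v"]) (auto intro!: span_add)
    show "(\<lambda>x. f x * g x) \<in> apply_bcontfun ` ?E"
      using prod[OF uv(1,2)] uv(3,4) by (metis (no_types, lifting) ext imageI)
  next
    fix c
    show "(\<lambda>_. c) \<in> apply_bcontfun ` ?E"
      by (intro image_eqI[of _ _ "c *\<^sub>R ridge exp 0"]) (auto simp: cexp intro!: span_scale[OF span_base])
  next
    fix x y :: "'n unit_sphere" assume "x \<noteq> y"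
    then have ne: "point_of x \<noteq> point_of y" by (simp add: point_of_inject)
    have "point_of x \<bullet> point_of x \<noteq> point_of y \<bullet> point_of x"
    proof
      assume "point_of x \<bullet> point_of x = point_of y \<bullet> point_of x"
      then have "(norm (point_of x - point_of y))\<^sup>2 = 0"
        by (simp add: power2_norm_eq_inner inner_diff inner_commute)
           (simp add: dot_square_norm)
      then show False using ne by simp
    qed
    then show "\<exists>f\<in>apply_bcontfun ` ?E. f x \<noteq> f y"
      by (intro bexI[of _ "apply_bcontfun (ridge exp (point_of x))"])
         (auto simp: cexp intro!: span_base)
  qed
  have "f \<in> closure ?E" for f :: "'n unit_sphere \<Rightarrow>\<^sub>C real"
    unfolding closure_approachable
  proof (intro allI impI)
    fix e :: real assume "e > 0"
    then obtain g where "g \<in> ?E" and g: "\<And>x. \<bar>apply_bcontfun f x - apply_bcontfun g x\<bar> < e / 2"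
      using F.Stone_Weierstrass_basic[of "apply_bcontfun f" "e / 2"] by fastforce
    moreover have "dist g f \<le> e / 2"
      using g by (intro dist_bound) (simp add: dist_real_def abs_minus_commute less_imp_le)
    ultimately show "\<exists>g\<in>?E. dist g f < e" using \<open>e > 0\<close> by (intro bexI[of _ g]) auto
  qed
  then show ?thesis by auto
qed

lemma positive_zonal_span_dense:
  assumes "summable a" and "\<And>n. a n > 0"
  shows "closure (span (range (zonal a))) = (UNIV :: ('n::finite unit_sphere \<Rightarrow>\<^sub>C real) set)"
proof -
  let ?V = "closure (span (range (zonal a))) :: ('n unit_sphere \<Rightarrow>\<^sub>C real) set"
  have V: "closed ?V" "subspace ?V" by (auto simp: subspace_closure_span)
  have exp_mem: "ridge exp z \<in> ?V" for z
  proof -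
    have s: "summable (\<lambda>n. \<bar>1 / fact n\<bar> * norm z ^ n)"
      using summable_exp[of "norm z"] by (simp add: divide_inverse)
    have "(\<Sum>n. (1 / fact n) *\<^sub>R ridge_power n z) = ridge exp z"
    proof (rule bcontfun_eqI)
      fix x :: "'n unit_sphere"
      have "(\<lambda>n. (1 / fact n) * (point_of x \<bullet> z) ^ n) sums exp (point_of x \<bullet> z)"
        using exp_converges[of "point_of x \<bullet> z"] by (simp add: divide_inverse)
      then show "apply_bcontfun (\<Sum>n. (1 / fact n) *\<^sub>R ridge_power n z) x = apply_bcontfun (ridge exp z) x"
        using sums_ridge_powers_apply[OF s, of x] sums_unique2 by (simp add: continuous_on_exp) blast
    qed
    then have "(\<lambda>n. (1 / fact n) *\<^sub>R ridge_power n z) sums ridge exp z"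
      using summable_sums[OF summable_ridge_powers[OF s]] by simp
    then show ?thesis
      by (rule closed_sums_mem[OF V, rotated])
         (intro subspace_scale[OF V(2)] ridge_power_mem_positive_zonal_span assms)
  qed
  have "span (range (ridge exp)) \<subseteq> ?V"
    using V(2) exp_mem by (intro span_minimal) auto
  then have "closure (span (range (ridge exp))) \<subseteq> ?V" using V(1) by (rule closure_minimal)
  then show ?thesis unfolding span_ridge_exp_dense by auto
qed

section \<open>Adding finitely many dimensions to a closed subspace\<close>

text \<open>
  If \<open>b\<close> has positive distance \<open>\<delta>\<close> from \<open>V\<close>, the coefficient of \<open>b\<close> in \<open>v + t *\<^sub>R b\<close> is bounded by the norm of the
  vector divided by \<open>\<delta>\<close>, so that convergence of such vectors forces convergence of the coefficients.
\<close>
lemma closed_subspace_add_vector: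
  fixes V :: "'a::real_normed_vector set"
  assumes V: "closed V" "subspace V"
  shows "closed {v + t *\<^sub>R b | v t. v \<in> V}"
proof (cases "b \<in> V")
  case True
  have "{v + t *\<^sub>R b | v t. v \<in> V} = V"
  proof
    show "{v + t *\<^sub>R b | v t. v \<in> V} \<subseteq> V"
      using True V(2) by (auto intro!: subspace_add subspace_scale)
    show "V \<subseteq> {v + t *\<^sub>R b | v t. v \<in> V}"
      by (auto intro!: exI[of _ "0 :: real"])
  qed
  then show ?thesis using V(1) by simp
next
  case False
  define \<delta> where "\<delta> = setdist {b} V"
  have \<delta>: "\<delta> > 0"
    using False V setdist_gt_0_compact_closed[of "{b}" V] subspace_0[OF V(2)]
    by (auto simp: \<delta>_def)
  have coeff: "\<bar>t\<bar> * \<delta> \<le> norm (v + t *\<^sub>R b)" if "v \<in> V" for v t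
  proof (cases "t = 0")
    case nz: False
    have "(- 1 / t) *\<^sub>R v \<in> V" using that V(2) by (rule subspace_scale[rotated])
    then have "\<delta> \<le> norm (b - (- 1 / t) *\<^sub>R v)"
      unfolding \<delta>_def using setdist_le_dist[of b "{b}" "(- 1 / t) *\<^sub>R v" V] by (simp add: dist_norm)
    then have "\<bar>t\<bar> * \<delta> \<le> norm (t *\<^sub>R (b - (- 1 / t) *\<^sub>R v))"
      by (simp add: mult_left_mono)
    also have "t *\<^sub>R (b - (- 1 / t) *\<^sub>R v) = v + t *\<^sub>R b"
      using nz by (simp add: algebra_simps)
    finally show ?thesis .
  qed auto
  show ?thesis unfolding closed_sequential_limits
  proof (intro allI impI, elim conjE)
    fix x l assume x: "\<forall>n. x n \<in> {v + t *\<^sub>R b | v t. v \<in> V}" and lim: "x \<longlonglongrightarrow> l"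
    then have "\<forall>n. \<exists>v t. v \<in> V \<and> x n = v + t *\<^sub>R b" by blast
    then obtain v t where v: "\<And>n. v n \<in> V" and xn: "\<And>n. x n = v n + t n *\<^sub>R b" by metis
    have "Cauchy t"
    proof (rule metric_CauchyI)
      fix e :: real assume "e > 0"
      then obtain N where N: "\<And>m n. m \<ge> N \<Longrightarrow> n \<ge> N \<Longrightarrow> dist (x m) (x n) < e * \<delta>"
        using metric_CauchyD[OF LIMSEQ_imp_Cauchy[OF lim], of "e * \<delta>"] \<delta> by auto
      have "dist (t m) (t n) < e" if "m \<ge> N" "n \<ge> N" for m n
      proof -
        have "\<bar>t m - t n\<bar> * \<delta> \<le> norm ((v m - v n) + (t m - t n) *\<^sub>R b)"
          using v V(2) by (intro coeff subspace_diff) auto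
        also have "\<dots> = dist (x m) (x n)" by (simp add: dist_norm xn algebra_simps)
        also have "\<dots> < e * \<delta>" by (rule N[OF that])
        finally show ?thesis using \<delta> by (simp add: dist_real_def)
      qed
      then show "\<exists>M. \<forall>m\<ge>M. \<forall>n\<ge>M. dist (t m) (t n) < e" by blast
    qed
    then obtain s where s: "t \<longlonglongrightarrow> s" using Cauchy_convergent_iff convergent_def by blast
    have "(\<lambda>n. x n - t n *\<^sub>R b) \<longlonglongrightarrow> l - s *\<^sub>R b" using lim s by (intro tendsto_intros)
    then have "l - s *\<^sub>R b \<in> V"
      by (rule closed_sequentially[OF V(1), rotated]) (use v in \<open>simp add: xn\<close>)
    then show "l \<in> {v + t *\<^sub>R b | v t. v \<in> V}"
      by (intro CollectI exI[of _ "l - s *\<^sub>R b"] exI[of _ s]) auto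
  qed
qed

lemma closed_span_Un_finite:
  fixes V :: "'a::real_normed_vector set"
  assumes "finite B" "closed V" "subspace V"
  shows "closed (span (V \<union> B))"
  using assms(1)
proof (induction B)
  case empty
  then show ?case using assms by (simp add: span_eq_iff[THEN iffD2])
next
  case (insert b B)
  have "span (V \<union> insert b B) = {v + t *\<^sub>R b | v t. v \<in> span (V \<union> B)}"
  proof -
    have "x \<in> span (insert b (V \<union> B)) \<longleftrightarrow> (\<exists>v t. x = v + t *\<^sub>R b \<and> v \<in> span (V \<union> B))" for x
    proof -
      have "x - t *\<^sub>R b = v \<longleftrightarrow> x = v + t *\<^sub>R b" for t v by (simp add: diff_eq_eq)
      then show ?thesis unfolding span_insert mem_Collect_eq by metis
    qed
    then show ?thesis by auto
  qed
  then show ?case using closed_subspace_add_vector[OF insert.IH subspace_span] by simp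
qed

text \<open>
  The degree bound is stated through the coefficients so that \<open>m = 0\<close> leaves only the zero function.
\<close>
definition ridge_polys_below :: "nat \<Rightarrow> ('n::finite unit_sphere \<Rightarrow>\<^sub>C real) set" where
  "ridge_polys_below m = {ridge_poly p (point_of y) | p y. \<forall>n\<ge>m. coeff p n = 0}"

text \<open>
  Degree-\<open>k\<close> polynomials form a finite-dimensional space. Multiplication by the coordinates carries a
  finite spanning set for degree \<open>k\<close> to one for degree \<open>Suc k\<close>.
\<close>
lemma ridge_power_mem_span_finite:
  "\<exists>B :: ('n::finite unit_sphere \<Rightarrow>\<^sub>C real) set. finite B \<and> (\<forall>z. ridge_power k z \<in> span B)"
proof (induction k)
  case 0
  show ?case
    by (intro exI[of _ "{ridge_power 0 0}"] conjI allI)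
       (auto intro!: span_base bcontfun_eqI simp: poly_monom)
next
  case (Suc k)
  then obtain B :: "('n unit_sphere \<Rightarrow>\<^sub>C real) set"
    where B: "finite B" "\<And>z. ridge_power k z \<in> span B" by blast
  define M where "M i u = Bcontfun (\<lambda>x. point_of x $ i * apply_bcontfun u x)"
    for i :: 'n and u :: "'n unit_sphere \<Rightarrow>\<^sub>C real"
  have M: "apply_bcontfun (M i u) x = point_of x $ i * apply_bcontfun u x" for i u x
    unfolding M_def
    by (subst Bcontfun_inverse)
       (auto intro!: continuous_imp_mem_bcontfun continuous_intros continuous_on_point_of)
  have "linear (M i)" for i
    by (intro linearI bcontfun_eqI) (auto simp: M algebra_simps)
  define C where "C = (\<Union>i. M i ` B)"
  have MC: "M i u \<in> span C" if "u \<in> span B" for i u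
  proof -
    have "M i u \<in> span (M i ` B)"
      using that linear_span_image[OF \<open>linear (M i)\<close>, of B] by auto
    then show ?thesis using span_mono[of "M i ` B" C] by (auto simp: C_def)
  qed
  show ?case
  proof (intro exI[of _ C] conjI allI)
    show "finite C" using B(1) by (simp add: C_def)
    fix z
    have "apply_bcontfun (\<Sum>i\<in>I. f i) x = (\<Sum>i\<in>I. apply_bcontfun (f i) x)"
      for I :: "'n set" and f :: "'n \<Rightarrow> 'n unit_sphere \<Rightarrow>\<^sub>C real" and x
      by (induction I rule: infinite_finite_induct) auto
    then have "ridge_power (Suc k) z = (\<Sum>i\<in>UNIV. (z $ i) *\<^sub>R M i (ridge_power k z))"
      by (intro bcontfun_eqI)
         (simp add: M poly_monom inner_vec_def sum_distrib_right mult_ac)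
    then show "ridge_power (Suc k) z \<in> span C"
      by (simp add: span_sum span_scale MC B(2))
  qed
qed

lemma ridge_poly_eq_sum_powers:
  assumes "\<forall>n\<ge>m. coeff p n = 0"
  shows "ridge_poly p z = (\<Sum>k<m. coeff p k *\<^sub>R ridge_power k z)"
proof -
  have "p = (\<Sum>k<m. monom (coeff p k) k)"
    using assms by (intro poly_eqI) (auto simp: coeff_sum if_distrib cong: if_cong)
  also have "\<dots> = (\<Sum>k<m. smult (coeff p k) (monom 1 k))" by (simp add: smult_monom)
  finally show ?thesis
    by (metis (no_types, lifting) ridge_poly_smult ridge_poly_sum sum.cong)
qed

lemma closed_span_Un_ridge_polys_below:
  fixes V :: "('n::finite unit_sphere \<Rightarrow>\<^sub>C real) set"
  assumes "closed V" "subspace V"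
  shows "closed (span (V \<union> ridge_polys_below m))"
proof -
  obtain B where B: "\<And>k. finite (B k)" "\<And>k z. ridge_power k z \<in> span (B k :: ('n unit_sphere \<Rightarrow>\<^sub>C real) set)"
    using ridge_power_mem_span_finite by metis
  have sub: "ridge_polys_below m \<subseteq> span (\<Union>k<m. B k)"
  proof
    fix u :: "'n unit_sphere \<Rightarrow>\<^sub>C real" assume "u \<in> ridge_polys_below m"
    then obtain p y where u: "u = ridge_poly p (point_of y)" "\<forall>n\<ge>m. coeff p n = 0"
      unfolding ridge_polys_below_def by blast
    have "ridge_power k z \<in> span (\<Union>k<m. B k)" if "k < m" for k z
      using B(2)[of k z] span_mono[of "B k" "\<Union>k<m. B k"] that by blast
    then show "u \<in> span (\<Union>k<m. B k)"
      unfolding u(1) ridge_poly_eq_sum_powers[OF u(2)] by (intro span_sum span_scale) auto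
  qed
  obtain C where C: "C \<subseteq> ridge_polys_below m" "independent C" "ridge_polys_below m \<subseteq> span (C :: ('n unit_sphere \<Rightarrow>\<^sub>C real) set)"
    using maximal_independent_subset by blast
  have "finite C"
    using independent_span_bound[of "\<Union>k<m. B k" C] B(1) C(1,2) sub by auto
  have "span (V \<union> ridge_polys_below m) = span (V \<union> C)"
  proof
    show "span (V \<union> C) \<subseteq> span (V \<union> ridge_polys_below m)"
      using C(1) by (intro span_mono) auto
    have "span C \<subseteq> span (V \<union> C)" by (intro span_mono) auto
    then show "span (V \<union> ridge_polys_below m) \<subseteq> span (V \<union> C)"
      using C(3) by (intro span_minimal subspace_span) (auto intro: span_base)
  qed
  then show ?thesis using closed_span_Un_finite[OF \<open>finite C\<close> assms] by simp
qed

section \<open>Rotations and the Laplacian of the sphere\<close>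

text \<open>
  The rotation by the angle \<open>\<epsilon>\<close> in the plane of the coordinates \<open>i\<close> and \<open>j\<close>, written as a perturbation of
  the identity so that inner products with fixed vectors expand directly. It is a rotation only if
  \<open>i \<noteq> j\<close>.
\<close>
definition rot :: "'n \<Rightarrow> 'n \<Rightarrow> real \<Rightarrow> real^'n \<Rightarrow> real^'n::finite" where
  "rot i j \<epsilon> x = x + (cos \<epsilon> - 1) *\<^sub>R (x $ i *\<^sub>R axis i 1 + x $ j *\<^sub>R axis j 1)
     + sin \<epsilon> *\<^sub>R (x $ j *\<^sub>R axis i 1 - x $ i *\<^sub>R axis j 1)"

lemma rot_inner:
  "rot i j \<epsilon> x \<bullet> z = x \<bullet> z + (cos \<epsilon> - 1) * (x $ i * z $ i + x $ j * z $ j)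
     + sin \<epsilon> * (x $ j * z $ i - x $ i * z $ j)"
  by (simp add: rot_def inner_add_left inner_diff_left inner_axis' inner_scaleR_left)

lemma rot_inner_adjoint: "rot i j \<epsilon> x \<bullet> z = x \<bullet> rot i j (-\<epsilon>) z"
  by (simp add: rot_inner inner_commute[of x "rot i j (-\<epsilon>) z"] inner_commute[of z x] algebra_simps)

lemma rot_nth:
  assumes "i \<noteq> j"
  shows "rot i j \<epsilon> x $ i = cos \<epsilon> * x $ i + sin \<epsilon> * x $ j"
    and "rot i j \<epsilon> x $ j = cos \<epsilon> * x $ j - sin \<epsilon> * x $ i"
  using assms by (simp_all add: rot_def axis_def algebra_simps)

lemma norm_rot:
  assumes "i \<noteq> j"
  shows "norm (rot i j \<epsilon> x) = norm x"
proof -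
  define S C where "S = sin \<epsilon>" and "C = cos \<epsilon>"
  have "rot i j \<epsilon> x \<bullet> rot i j \<epsilon> x
      = x \<bullet> x + ((x $ i)\<^sup>2 + (x $ j)\<^sup>2) * (S\<^sup>2 + C\<^sup>2 - 1)"
    by (simp add: rot_inner inner_commute[of x "rot i j \<epsilon> x"] rot_nth[OF assms]
        algebra_simps power2_eq_square S_def[symmetric] C_def[symmetric])
  also have "S\<^sup>2 + C\<^sup>2 - 1 = 0" by (simp add: S_def C_def)
  finally have "rot i j \<epsilon> x \<bullet> rot i j \<epsilon> x = x \<bullet> x" by simp
  then show ?thesis by (simp add: norm_eq_sqrt_inner)
qed

definition rotate_fun :: "'n \<Rightarrow> 'n \<Rightarrow> real \<Rightarrow> ('n::finite unit_sphere \<Rightarrow>\<^sub>C real) \<Rightarrow> ('n unit_sphere \<Rightarrow>\<^sub>C real)" where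
  "rotate_fun i j \<epsilon> u = Bcontfun (\<lambda>x. apply_bcontfun u (unit_sphere_of (rot i j \<epsilon> (point_of x))))"

lemma point_of_rot:
  assumes "i \<noteq> j"
  shows "point_of (unit_sphere_of (rot i j \<epsilon> (point_of x))) = rot i j \<epsilon> (point_of x)"
  using assms by (intro unit_sphere_of_inverse) (simp add: norm_rot)

lemma apply_rotate_fun:
  assumes "i \<noteq> j"
  shows "apply_bcontfun (rotate_fun i j \<epsilon> u) x = apply_bcontfun u (unit_sphere_of (rot i j \<epsilon> (point_of x)))"
proof -
  have "continuous_on UNIV (\<lambda>x. rot i j \<epsilon> (point_of x))"
    unfolding rot_def by (intro continuous_intros continuous_on_point_of)
  then have "continuous_on UNIV (\<lambda>x. unit_sphere_of (rot i j \<epsilon> (point_of x)))"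
    by (rule continuous_on_compose2[OF continuous_on_unit_sphere_of])
       (auto simp: norm_rot[OF assms])
  then have "continuous_on UNIV (\<lambda>x. apply_bcontfun u (unit_sphere_of (rot i j \<epsilon> (point_of x))))"
    by (rule continuous_on_compose2[OF continuous_on_apply_bcontfun]) auto
  from Bcontfun_inverse[OF continuous_imp_mem_bcontfun[OF this]]
  show ?thesis by (simp add: rotate_fun_def)
qed

lemma apply_rotate_fun_ridge_poly:
  assumes "i \<noteq> j"
  shows "apply_bcontfun (rotate_fun i j \<epsilon> (ridge_poly p z)) x = poly p (rot i j \<epsilon> (point_of x) \<bullet> z)"
  by (simp add: apply_rotate_fun[OF assms] point_of_rot[OF assms])

lemma bounded_linear_rotate_fun:
  assumes "i \<noteq> j"
  shows "bounded_linear (rotate_fun i j \<epsilon>)"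
proof
  show "\<exists>K. \<forall>u. norm (rotate_fun i j \<epsilon> u) \<le> norm u * K"
    by (intro exI[of _ 1] allI norm_bound) (simp only: apply_rotate_fun[OF assms] norm_bounded mult_1_right)
qed (auto intro!: bcontfun_eqI simp: apply_rotate_fun[OF assms])

lemma rotate_zonal:
  assumes "i \<noteq> j" "summable (\<lambda>n. \<bar>a n\<bar>)"
  shows "rotate_fun i j \<epsilon> (zonal a y) = zonal a (unit_sphere_of (rot i j (-\<epsilon>) (point_of y)))"
proof -
  have "(\<lambda>n. rotate_fun i j \<epsilon> (a n *\<^sub>R ridge_power n (point_of y))) sums rotate_fun i j \<epsilon> (zonal a y)"
    by (intro bounded_linear.sums[OF bounded_linear_rotate_fun] assms sums_zonal)
  moreover have "rotate_fun i j \<epsilon> (a n *\<^sub>R ridge_power n (point_of y))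
      = a n *\<^sub>R ridge_power n (point_of (unit_sphere_of (rot i j (-\<epsilon>) (point_of y))))" for n
    by (intro bcontfun_eqI)
       (simp add: apply_rotate_fun[OF assms(1)] point_of_rot[OF assms(1)] rot_inner_adjoint)
  ultimately have "(\<lambda>n. a n *\<^sub>R ridge_power n (point_of (unit_sphere_of (rot i j (- \<epsilon>) (point_of y)))))
      sums rotate_fun i j \<epsilon> (zonal a y)" by (simp only:)
  then show ?thesis using sums_zonal[OF assms(2)] by (rule sums_unique2)
qed

definition rotation_invariant :: "('n::finite unit_sphere \<Rightarrow>\<^sub>C real) set \<Rightarrow> bool" where
  "rotation_invariant V \<longleftrightarrow> (\<forall>i j \<epsilon> u. i \<noteq> j \<longrightarrow> u \<in> V \<longrightarrow> rotate_fun i j \<epsilon> u \<in> V)"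

lemma rotation_invariant_zonal_span:
  assumes "summable (\<lambda>n. \<bar>a n\<bar>)"
  shows "rotation_invariant (closure (span (range (zonal a :: 'n::finite unit_sphere \<Rightarrow> _))))"
  unfolding rotation_invariant_def
proof (intro allI impI)
  fix i j :: 'n and \<epsilon> and u :: "'n unit_sphere \<Rightarrow>\<^sub>C real"
  assume ij: "i \<noteq> j" and u: "u \<in> closure (span (range (zonal a)))"
  have lin: "bounded_linear (rotate_fun i j \<epsilon>)" by (rule bounded_linear_rotate_fun[OF ij])
  have "rotate_fun i j \<epsilon> ` span (range (zonal a)) = span (rotate_fun i j \<epsilon> ` range (zonal a))"
    using linear_span_image[OF bounded_linear.linear[OF lin]] by metis
  also have "\<dots> \<subseteq> span (range (zonal a))"
    by (intro span_mono) (auto simp: rotate_zonal[OF ij assms])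
  finally have "rotate_fun i j \<epsilon> ` span (range (zonal a)) \<subseteq> closure (span (range (zonal a)))"
    using closure_subset by blast
  then have "rotate_fun i j \<epsilon> ` closure (span (range (zonal a))) \<subseteq> closure (span (range (zonal a)))"
    by (intro image_closure_subset linear_continuous_on[OF lin]) auto
  then show "rotate_fun i j \<epsilon> u \<in> closure (span (range (zonal a)))" using u by blast
qed

text \<open>
  The sum runs over ordered pairs. As \<open>(i, j)\<close> and \<open>(j, i)\<close> rotate by opposite angles, their two terms form a
  symmetric second difference; its limit is the second derivative along the rotation, and the sum of these
  over all coordinate planes is the Laplacian of the sphere. Using only rotations, the limit stays in any
  closed rotation-invariant subspace.
\<close>
definition rotation_difference :: "real \<Rightarrow> ('n::finite unit_sphere \<Rightarrow>\<^sub>C real) \<Rightarrow> ('n unit_sphere \<Rightarrow>\<^sub>C real)" where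
  "rotation_difference \<epsilon> u = (1 / \<epsilon>\<^sup>2) *\<^sub>R (\<Sum>i\<in>UNIV. \<Sum>j\<in>UNIV - {i}. rotate_fun i j \<epsilon> u - u)"

definition has_laplacian :: "('n::finite unit_sphere \<Rightarrow>\<^sub>C real) \<Rightarrow> ('n unit_sphere \<Rightarrow>\<^sub>C real) \<Rightarrow> bool" where
  "has_laplacian u w \<longleftrightarrow> ((\<lambda>\<epsilon>. rotation_difference \<epsilon> u) \<longlongrightarrow> w) (at 0)"

lemma linear_rotation_difference: "linear (rotation_difference \<epsilon>)"
proof (rule linearI)
  note lin = bounded_linear.linear[OF bounded_linear_rotate_fun]
  show "rotation_difference \<epsilon> (u + v) = rotation_difference \<epsilon> u + rotation_difference \<epsilon> v" for u v
    unfolding rotation_difference_def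
    by (simp add: linear_add[OF lin] add_diff_add sum.distrib scaleR_add_right)
  show "rotation_difference \<epsilon> (c *\<^sub>R u) = c *\<^sub>R rotation_difference \<epsilon> u" for u c
    unfolding rotation_difference_def
    by (simp add: linear_scale[OF lin] scaleR_diff_right[symmetric] scaleR_sum_right[symmetric] mult.commute)
qed

lemma has_laplacian_add: "has_laplacian u w \<Longrightarrow> has_laplacian u' w' \<Longrightarrow> has_laplacian (u + u') (w + w')"
  and has_laplacian_scale: "has_laplacian u w \<Longrightarrow> has_laplacian (c *\<^sub>R u) (c *\<^sub>R w)"
  and has_laplacian_0: "has_laplacian 0 0"
  unfolding has_laplacian_def
  by (simp_all add: linear_add[OF linear_rotation_difference] linear_scale[OF linear_rotation_difference]
       linear_0[OF linear_rotation_difference] tendsto_add tendsto_scaleR)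

lemma has_laplacian_mem:
  assumes V: "closed V" "subspace V" "rotation_invariant V" and "u \<in> V" "has_laplacian u w"
  shows "w \<in> V"
proof (rule Lim_in_closed_set[OF V(1)])
  show "((\<lambda>\<epsilon>. rotation_difference \<epsilon> u) \<longlongrightarrow> w) (at 0)" using assms(5) by (simp add: has_laplacian_def)
  show "\<forall>\<^sub>F \<epsilon> in at 0. rotation_difference \<epsilon> u \<in> V"
    using assms(3,4) unfolding rotation_difference_def rotation_invariant_def
    by (intro always_eventually allI subspace_scale subspace_sum subspace_diff V(2)) auto
qed auto

text \<open>
  The Laplacian of the sphere in \<open>d\<close>-dimensional space, acting on the profile \<open>p\<close> of a zonal function
  \<open>x \<mapsto> p (x \<bullet> z)\<close>.
\<close>
definition gegenbauer_op :: "nat \<Rightarrow> real poly \<Rightarrow> real poly" where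
  "gegenbauer_op d p = [:1, 0, -1:] * pderiv (pderiv p) - smult (real d - 1) ([:0, 1:] * pderiv p)"

lemma bounded_poly_unit_interval:
  fixes p :: "real poly"
  obtains B where "B \<ge> 0" "\<And>s. \<bar>s\<bar> \<le> 1 \<Longrightarrow> \<bar>poly p s\<bar> \<le> B"
proof -
  have "bounded (poly p ` {-1..1})"
    by (intro compact_imp_bounded compact_continuous_image continuous_on_poly_fun compact_Icc)
  then obtain B where "B > 0" "\<forall>s\<in>{-1..1}. \<bar>poly p s\<bar> \<le> B"
    unfolding bounded_pos by auto
  then show ?thesis by (intro that[of B]) (auto simp: abs_le_iff)
qed

lemma poly_second_order_taylor:
  fixes p :: "real poly"
  shows "\<exists>C\<ge>0. \<forall>s h. \<bar>s\<bar> \<le> 1 \<longrightarrow> \<bar>h\<bar> \<le> 4 \<longrightarrow>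
    \<bar>poly p (s + h) - poly p s - poly (pderiv p) s * h - poly (pderiv (pderiv p)) s * h\<^sup>2 / 2\<bar> \<le> C * \<bar>h\<bar> ^ 3"
proof (induction p)
  case 0
  show ?case by (intro exI[of _ 0]) auto
next
  case (pCons a p)
  then obtain C where C: "C \<ge> 0" and rem: "\<And>s h. \<bar>s\<bar> \<le> 1 \<Longrightarrow> \<bar>h\<bar> \<le> 4 \<Longrightarrow>
    \<bar>poly p (s + h) - poly p s - poly (pderiv p) s * h - poly (pderiv (pderiv p)) s * h\<^sup>2 / 2\<bar> \<le> C * \<bar>h\<bar> ^ 3"
    by blast
  obtain D where D: "D \<ge> 0" "\<And>s. \<bar>s\<bar> \<le> 1 \<Longrightarrow> \<bar>poly (pderiv (pderiv p)) s\<bar> \<le> D"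
    using bounded_poly_unit_interval[of "pderiv (pderiv p)"] by blast
  show ?case
  proof (intro exI[of _ "5 * C + D"] conjI allI impI)
    fix s h :: real assume s: "\<bar>s\<bar> \<le> 1" and h: "\<bar>h\<bar> \<le> 4"
    define R where "R = poly p (s + h) - poly p s - poly (pderiv p) s * h - poly (pderiv (pderiv p)) s * h\<^sup>2 / 2"
    have "poly (pCons a p) (s + h) - poly (pCons a p) s - poly (pderiv (pCons a p)) s * h
            - poly (pderiv (pderiv (pCons a p))) s * h\<^sup>2 / 2
        = (s + h) * R + poly (pderiv (pderiv p)) s / 2 * h ^ 3"
      by (simp add: pderiv_pCons pderiv_add R_def field_simps power2_eq_square power3_eq_cube)
    also have "\<bar>\<dots>\<bar> \<le> \<bar>s + h\<bar> * \<bar>R\<bar> + \<bar>poly (pderiv (pderiv p)) s\<bar> / 2 * \<bar>h\<bar> ^ 3"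
      by (rule order_trans[OF abs_triangle_ineq]) (simp add: abs_mult power_abs)
    also have "\<dots> \<le> 5 * (C * \<bar>h\<bar> ^ 3) + D * \<bar>h\<bar> ^ 3"
      using s h rem[OF s h] D(2)[OF s] D(1)
      by (intro add_mono mult_mono) (auto simp: R_def)
    finally show "\<bar>poly (pCons a p) (s + h) - poly (pCons a p) s - poly (pderiv (pCons a p)) s * h
            - poly (pderiv (pderiv (pCons a p))) s * h\<^sup>2 / 2\<bar> \<le> (5 * C + D) * \<bar>h\<bar> ^ 3"
      by (simp add: algebra_simps)
  qed (use C D in auto)
qed

lemma sum_off_diagonal:
  fixes f :: "'n::finite \<Rightarrow> 'n \<Rightarrow> real"
  shows "(\<Sum>i\<in>UNIV. \<Sum>j\<in>UNIV - {i}. f i j) = (\<Sum>i\<in>UNIV. \<Sum>j\<in>UNIV. f i j) - (\<Sum>i\<in>UNIV. f i i)"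
  by (simp add: sum_diff1 sum_subtractf)

lemma sum_off_diagonal_antisym:
  fixes f :: "'n::finite \<Rightarrow> 'n \<Rightarrow> real"
  assumes "\<And>i j. f j i = - f i j"
  shows "(\<Sum>i\<in>UNIV. \<Sum>j\<in>UNIV - {i}. f i j) = 0"
proof -
  have "(\<Sum>i\<in>UNIV. \<Sum>j\<in>UNIV. f i j) = - (\<Sum>i\<in>UNIV. \<Sum>j\<in>UNIV. f i j)"
    by (subst sum.swap) (simp add: assms[of _ _] sum_negf[symmetric] flip: assms)
  moreover have "f i i = 0" for i using assms[of i i] by simp
  ultimately show ?thesis by (simp add: sum_off_diagonal)
qed

text \<open>
  These are the sums of the first- and second-order terms in the expansion of \<open>rot i j \<epsilon> x \<bullet> z\<close> over all planes.
  The second is Lagrange's identity for \<open>x\<close> and \<open>z\<close>.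
\<close>
lemma sum_rotation_symbols:
  fixes x z :: "real^'n::finite"
  assumes "norm x = 1" "norm z = 1"
  shows "(\<Sum>i\<in>UNIV. \<Sum>j\<in>UNIV - {i}. x $ i * z $ i + x $ j * z $ j) = 2 * (real CARD('n) - 1) * (x \<bullet> z)"
    and "(\<Sum>i\<in>UNIV. \<Sum>j\<in>UNIV - {i}. (x $ j * z $ i - x $ i * z $ j)\<^sup>2) = 2 * (1 - (x \<bullet> z)\<^sup>2)"
proof -
  have xz: "x \<bullet> z = (\<Sum>i\<in>UNIV. x $ i * z $ i)" by (simp add: inner_vec_def)
  have x1: "(\<Sum>i\<in>UNIV. x $ i * x $ i) = 1"
    using assms(1) dot_square_norm[of x] by (simp add: inner_vec_def)
  have z1: "(\<Sum>i\<in>UNIV. z $ i * z $ i) = 1"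
    using assms(2) dot_square_norm[of z] by (simp add: inner_vec_def)
  have full: "(\<Sum>i\<in>UNIV. \<Sum>j\<in>UNIV. x $ i * z $ i + x $ j * z $ j) = real CARD('n) * (x \<bullet> z) + real CARD('n) * (x \<bullet> z)"
    unfolding sum.distrib sum_constant sum_distrib_left[symmetric] xz by simp
  have diag: "(\<Sum>i\<in>UNIV. x $ i * z $ i + x $ i * z $ i) = x \<bullet> z + x \<bullet> z"
    unfolding sum.distrib xz ..
  show "(\<Sum>i\<in>UNIV. \<Sum>j\<in>UNIV - {i}. x $ i * z $ i + x $ j * z $ j) = 2 * (real CARD('n) - 1) * (x \<bullet> z)"
    unfolding sum_off_diagonal full diag by (simp add: algebra_simps)
  have "(\<Sum>i\<in>UNIV. \<Sum>j\<in>UNIV. (x $ j * z $ i - x $ i * z $ j)\<^sup>2)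
      = (\<Sum>i\<in>UNIV. \<Sum>j\<in>UNIV. (z $ i * z $ i) * (x $ j * x $ j) + (x $ i * x $ i) * (z $ j * z $ j)
          - 2 * ((x $ i * z $ i) * (x $ j * z $ j)))"
    by (intro sum.cong refl) (simp add: power2_eq_square algebra_simps)
  also have "\<dots> = 2 * (1 - (x \<bullet> z)\<^sup>2)"
    unfolding sum.distrib sum_subtractf sum_distrib_left[symmetric] sum_distrib_right[symmetric]
      x1 z1 xz[symmetric] by (simp add: power2_eq_square)
  finally show "(\<Sum>i\<in>UNIV. \<Sum>j\<in>UNIV - {i}. (x $ j * z $ i - x $ i * z $ j)\<^sup>2) = 2 * (1 - (x \<bullet> z)\<^sup>2)"
    by (simp add: sum_off_diagonal)
qed

lemma abs_cos_minus_1_le: "\<bar>cos \<epsilon> - 1\<bar> \<le> \<bar>\<epsilon>\<bar>" for \<epsilon> :: real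
proof -
  have "cos \<epsilon> - 1 = - 2 * (sin (\<epsilon> / 2))\<^sup>2"
    using cos_double_sin[of "\<epsilon> / 2"] by simp
  then have "\<bar>cos \<epsilon> - 1\<bar> = 2 * (\<bar>sin (\<epsilon> / 2)\<bar> * \<bar>sin (\<epsilon> / 2)\<bar>)"
    by (simp add: abs_mult power2_eq_square)
  also have "\<dots> \<le> 2 * (\<bar>\<epsilon> / 2\<bar> * 1)"
    by (intro mult_left_mono mult_mono abs_sin_x_le_abs_x) auto
  finally show ?thesis by simp
qed

text \<open>
  Under the rotation by \<open>\<epsilon>\<close>, the inner product \<open>s\<close> of \<open>x\<close> and \<open>z\<close> changes by
  \<open>h i j = (cos \<epsilon> - 1) * A i j + sin \<epsilon> * B i j\<close> with \<open>A\<close> symmetric and \<open>B\<close> antisymmetric. In the second-order Taylor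
  expansion of \<open>p\<close> at \<open>s\<close>, summed over all ordered pairs, the terms linear in \<open>B\<close> cancel. The remaining terms of order
  \<open>\<epsilon>\<^sup>2\<close> are the asserted operator, and the error, bounded by \<open>E \<epsilon>\<close>, is uniform in \<open>x\<close>.
\<close>
lemma has_laplacian_ridge_poly:
  fixes z :: "real^'n::finite"
  assumes z: "norm z = 1"
  shows "has_laplacian (ridge_poly p z) (ridge_poly (gegenbauer_op CARD('n) p) z)"
proof -
  define d where "d = real CARD('n)"
  obtain C where C: "C \<ge> 0" and rem: "\<And>s h. \<bar>s\<bar> \<le> 1 \<Longrightarrow> \<bar>h\<bar> \<le> 4 \<Longrightarrow>
    \<bar>poly p (s + h) - poly p s - poly (pderiv p) s * h - poly (pderiv (pderiv p)) s * h\<^sup>2 / 2\<bar> \<le> C * \<bar>h\<bar> ^ 3"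
    using poly_second_order_taylor[of p] by blast
  obtain B1 where B1: "B1 \<ge> 0" "\<And>s. \<bar>s\<bar> \<le> 1 \<Longrightarrow> \<bar>poly (pderiv p) s\<bar> \<le> B1"
    using bounded_poly_unit_interval[of "pderiv p"] by blast
  obtain B2 where B2: "B2 \<ge> 0" "\<And>s. \<bar>s\<bar> \<le> 1 \<Longrightarrow> \<bar>poly (pderiv (pderiv p)) s\<bar> \<le> B2"
    using bounded_poly_unit_interval[of "pderiv (pderiv p)"] by blast
  have d: "d \<ge> 1" by (simp add: d_def Suc_leI)
  define E where "E \<epsilon> = B1 * d * \<bar>2 * (cos \<epsilon> - 1) / \<epsilon>\<^sup>2 + 1\<bar> + B2 * \<bar>(sin \<epsilon>)\<^sup>2 / \<epsilon>\<^sup>2 - 1\<bar>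
      + 2 * B2 * d\<^sup>2 * ((cos \<epsilon> - 1)\<^sup>2 / \<epsilon>\<^sup>2) + 64 * C * d\<^sup>2 * \<bar>\<epsilon>\<bar>" for \<epsilon> :: real
  have t1: "((\<lambda>\<epsilon>::real. 2 * (cos \<epsilon> - 1) / \<epsilon>\<^sup>2 + 1) \<longlongrightarrow> 0) (at 0)" by real_asymp
  have t2: "((\<lambda>\<epsilon>::real. (sin \<epsilon>)\<^sup>2 / \<epsilon>\<^sup>2 - 1) \<longlongrightarrow> 0) (at 0)" by real_asymp
  have t3: "((\<lambda>\<epsilon>::real. (cos \<epsilon> - 1)\<^sup>2 / \<epsilon>\<^sup>2) \<longlongrightarrow> 0) (at 0)" by real_asymp
  have t4: "((\<lambda>\<epsilon>::real. \<bar>\<epsilon>\<bar>) \<longlongrightarrow> 0) (at 0)" by (intro tendsto_rabs_zero tendsto_ident_at)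
  have E0: "(E \<longlongrightarrow> 0) (at 0)"
    unfolding E_def[abs_def]
    using tendsto_add_zero[OF tendsto_add_zero[OF tendsto_add_zero[OF
      tendsto_mult_right_zero[OF tendsto_rabs_zero[OF t1], of "B1 * d"]
      tendsto_mult_right_zero[OF tendsto_rabs_zero[OF t2], of B2]]
      tendsto_mult_right_zero[OF t3, of "2 * B2 * d\<^sup>2"]]
      tendsto_mult_right_zero[OF t4, of "64 * C * d\<^sup>2"]] .
  have main: "norm (rotation_difference \<epsilon> (ridge_poly p z) - ridge_poly (gegenbauer_op CARD('n) p) z) \<le> E \<epsilon>"
    if \<epsilon>: "\<epsilon> \<noteq> 0" "\<bar>\<epsilon>\<bar> \<le> 1" for \<epsilon>
  proof (rule norm_bound)
    fix x :: "'n unit_sphere"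
    define X where "X = point_of x"
    have X: "norm X = 1" by (simp add: X_def)
    define s where "s = X \<bullet> z"
    define c where "c = cos \<epsilon> - 1"
    define \<sigma> where "\<sigma> = sin \<epsilon>"
    define A where "A i j = X $ i * z $ i + X $ j * z $ j" for i j
    define B where "B i j = X $ j * z $ i - X $ i * z $ j" for i j
    define h where "h i j = c * A i j + \<sigma> * B i j" for i j
    define r where "r i j = poly p (s + h i j) - poly p s - poly (pderiv p) s * h i j
        - poly (pderiv (pderiv p)) s * (h i j)\<^sup>2 / 2" for i j
    define S where "S f = (\<Sum>i\<in>UNIV. \<Sum>j\<in>UNIV - {i}. f i j)" for f :: "'n \<Rightarrow> 'n \<Rightarrow> real"
    have S_add: "S (\<lambda>i j. f i j + g i j) = S f + S g"
      and S_scale: "S (\<lambda>i j. k * f i j) = k * S f" for f g k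
      by (simp_all add: S_def sum.distrib sum_distrib_left)
    have S_bound: "\<bar>S f\<bar> \<le> d\<^sup>2 * K" if "\<And>i j. \<bar>f i j\<bar> \<le> K" for f K
    proof -
      have K: "K \<ge> 0" using that[of undefined undefined] by linarith
      have "\<bar>S f\<bar> \<le> (\<Sum>i\<in>UNIV. \<Sum>j\<in>UNIV - {i}. \<bar>f i j\<bar>)"
        unfolding S_def by (intro order_trans[OF sum_abs] sum_mono sum_abs)
      also have "\<dots> \<le> (\<Sum>i\<in>(UNIV :: 'n set). \<Sum>j\<in>(UNIV :: 'n set). K)"
        using that by (intro sum_mono order_trans[OF sum_mono2[of UNIV]] ) auto
      finally show ?thesis by (simp add: d_def power2_eq_square)
    qed
    have s: "\<bar>s\<bar> \<le> 1" using Cauchy_Schwarz_ineq2[of X z] X z by (simp add: s_def)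
    have comp: "\<bar>X $ i * z $ j\<bar> \<le> 1" for i j
      using component_le_norm_cart[of X i] component_le_norm_cart[of z j] X z
      by (simp add: abs_mult mult_le_one)
    have A: "\<bar>A i j\<bar> \<le> 2" for i j
      using comp[of i i] comp[of j j] unfolding A_def by linarith
    have B: "\<bar>B i j\<bar> \<le> 2" for i j
      using comp[of j i] comp[of i j] unfolding B_def by linarith
    have h: "\<bar>h i j\<bar> \<le> 4 * \<bar>\<epsilon>\<bar>" for i j
    proof -
      have "\<bar>h i j\<bar> \<le> \<bar>c\<bar> * \<bar>A i j\<bar> + \<bar>\<sigma>\<bar> * \<bar>B i j\<bar>"
        unfolding h_def by (rule order_trans[OF abs_triangle_ineq]) (simp add: abs_mult)
      also have "\<dots> \<le> \<bar>\<epsilon>\<bar> * 2 + \<bar>\<epsilon>\<bar> * 2"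
        using abs_cos_minus_1_le[of \<epsilon>] abs_sin_x_le_abs_x[of \<epsilon>]
        by (intro add_mono mult_mono A B) (auto simp: c_def \<sigma>_def)
      finally show ?thesis by simp
    qed
    have r: "\<bar>r i j\<bar> \<le> 64 * C * \<bar>\<epsilon>\<bar> ^ 3" for i j
    proof -
      have "\<bar>r i j\<bar> \<le> C * \<bar>h i j\<bar> ^ 3"
        unfolding r_def using h[of i j] \<epsilon>(2) by (intro rem s) linarith
      also have "\<dots> \<le> C * (4 * \<bar>\<epsilon>\<bar>) ^ 3"
        by (intro mult_left_mono power_mono h C) auto
      finally show ?thesis by (simp add: power_mult_distrib)
    qed
    have SA: "S A = 2 * (d - 1) * s"
      using sum_rotation_symbols(1)[OF X z] by (simp add: S_def A_def d_def s_def)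
    have SB2: "S (\<lambda>i j. (B i j)\<^sup>2) = 2 * (1 - s\<^sup>2)"
      using sum_rotation_symbols(2)[OF X z] by (simp add: S_def B_def s_def)
    have SB: "S B = 0"
      unfolding S_def by (rule sum_off_diagonal_antisym) (simp add: B_def)
    have SAB: "S (\<lambda>i j. A i j * B i j) = 0"
      unfolding S_def by (rule sum_off_diagonal_antisym) (simp add: A_def B_def algebra_simps)
    have Sh: "S h = 2 * c * (d - 1) * s"
      unfolding h_def[abs_def] S_add S_scale SA SB by simp
    have "(h i j)\<^sup>2 = c\<^sup>2 * (A i j)\<^sup>2 + (2 * c * \<sigma> * (A i j * B i j) + \<sigma>\<^sup>2 * (B i j)\<^sup>2)" for i j
      by (simp add: h_def power2_eq_square algebra_simps)
    then have Sh2: "S (\<lambda>i j. (h i j)\<^sup>2) = c\<^sup>2 * S (\<lambda>i j. (A i j)\<^sup>2) + 2 * \<sigma>\<^sup>2 * (1 - s\<^sup>2)"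
      by (simp add: S_add S_scale SAB SB2)
    have "apply_bcontfun (\<Sum>i\<in>UNIV. \<Sum>j\<in>UNIV - {i}. rotate_fun i j \<epsilon> (ridge_poly p z) - ridge_poly p z) x
        = S (\<lambda>i j. poly p (s + h i j) - poly p s)"
    proof -
      have app_sum: "apply_bcontfun (\<Sum>i\<in>I. f i) x = (\<Sum>i\<in>I. apply_bcontfun (f i) x)"
        for I :: "'n set" and f :: "'n \<Rightarrow> 'n unit_sphere \<Rightarrow>\<^sub>C real"
        by (induction I rule: infinite_finite_induct) auto
      have "apply_bcontfun (rotate_fun i j \<epsilon> (ridge_poly p z)) x = poly p (s + h i j)" if "j \<in> UNIV - {i}" for i j
      proof -
        have "i \<noteq> j" using that by auto
        then show ?thesis
          by (simp add: apply_rotate_fun_ridge_poly rot_inner X_def[symmetric] s_def h_def A_def B_def c_def \<sigma>_def add.assoc)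
      qed
      then show ?thesis
        unfolding S_def app_sum by (intro sum.cong refl) (simp add: X_def[symmetric] s_def)
    qed
    also have "(\<lambda>i j. poly p (s + h i j) - poly p s) = (\<lambda>i j. poly (pderiv p) s * h i j
        + (poly (pderiv (pderiv p)) s / 2 * (h i j)\<^sup>2 + r i j))"
      by (intro ext) (simp add: r_def)
    also have "S \<dots> = poly (pderiv p) s * (2 * c * (d - 1) * s)
        + (poly (pderiv (pderiv p)) s / 2 * (c\<^sup>2 * S (\<lambda>i j. (A i j)\<^sup>2) + 2 * \<sigma>\<^sup>2 * (1 - s\<^sup>2)) + S r)"
      unfolding S_add S_scale Sh Sh2 ..
    finally have val: "apply_bcontfun (rotation_difference \<epsilon> (ridge_poly p z)) x
      = (poly (pderiv p) s * (2 * c * (d - 1) * s)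
        + (poly (pderiv (pderiv p)) s / 2 * (c\<^sup>2 * S (\<lambda>i j. (A i j)\<^sup>2) + 2 * \<sigma>\<^sup>2 * (1 - s\<^sup>2)) + S r)) / \<epsilon>\<^sup>2"
      by (simp add: rotation_difference_def)
    have L: "apply_bcontfun (ridge_poly (gegenbauer_op CARD('n) p) z) x
      = (1 - s\<^sup>2) * poly (pderiv (pderiv p)) s - (d - 1) * s * poly (pderiv p) s"
      by (simp add: gegenbauer_op_def X_def[symmetric] s_def d_def power2_eq_square algebra_simps)
    define T1 where "T1 = poly (pderiv p) s * ((d - 1) * s) * (2 * c / \<epsilon>\<^sup>2 + 1)"
    define T2 where "T2 = poly (pderiv (pderiv p)) s * (1 - s\<^sup>2) * (\<sigma>\<^sup>2 / \<epsilon>\<^sup>2 - 1)"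
    define T3 where "T3 = poly (pderiv (pderiv p)) s / 2 * S (\<lambda>i j. (A i j)\<^sup>2) * (c\<^sup>2 / \<epsilon>\<^sup>2)"
    define T4 where "T4 = S r / \<epsilon>\<^sup>2"
    have split: "apply_bcontfun (rotation_difference \<epsilon> (ridge_poly p z) - ridge_poly (gegenbauer_op CARD('n) p) z) x
      = T1 + (T2 + (T3 + T4))"
      unfolding minus_bcontfun.rep_eq val L T1_def T2_def T3_def T4_def
      by (simp add: add_divide_distrib diff_divide_distrib algebra_simps)
    have "\<bar>T1 + (T2 + (T3 + T4))\<bar> \<le> \<bar>T1\<bar> + (\<bar>T2\<bar> + (\<bar>T3\<bar> + \<bar>T4\<bar>))"
      by linarith
    also have "\<dots> \<le> B1 * (d * 1) * \<bar>2 * c / \<epsilon>\<^sup>2 + 1\<bar> + (B2 * 1 * \<bar>\<sigma>\<^sup>2 / \<epsilon>\<^sup>2 - 1\<bar>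
        + (B2 / 2 * (d\<^sup>2 * 4) * (c\<^sup>2 / \<epsilon>\<^sup>2) + d\<^sup>2 * (64 * C * \<bar>\<epsilon>\<bar> ^ 3) / \<epsilon>\<^sup>2))"
    proof (intro add_mono)
      show "\<bar>T1\<bar> \<le> B1 * (d * 1) * \<bar>2 * c / \<epsilon>\<^sup>2 + 1\<bar>"
        unfolding T1_def abs_mult using B1 s d by (intro mult_mono mult_nonneg_nonneg) auto
      have "\<bar>1 - s\<^sup>2\<bar> \<le> 1" using s by (simp add: abs_square_le_1)
      then show "\<bar>T2\<bar> \<le> B2 * 1 * \<bar>\<sigma>\<^sup>2 / \<epsilon>\<^sup>2 - 1\<bar>"
        unfolding T2_def abs_mult using B2 s by (intro mult_mono mult_nonneg_nonneg) auto
      have "\<bar>(A i j)\<^sup>2\<bar> \<le> 4" for i j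
        using power_mono[OF A[of i j], of 2] by (simp add: power2_abs)
      then have "\<bar>S (\<lambda>i j. (A i j)\<^sup>2)\<bar> \<le> d\<^sup>2 * 4" by (intro S_bound)
      then show "\<bar>T3\<bar> \<le> B2 / 2 * (d\<^sup>2 * 4) * (c\<^sup>2 / \<epsilon>\<^sup>2)"
        unfolding T3_def abs_mult using B2 s by (intro mult_mono mult_nonneg_nonneg) auto
      have "\<bar>S r\<bar> \<le> d\<^sup>2 * (64 * C * \<bar>\<epsilon>\<bar> ^ 3)" by (intro S_bound r)
      then show "\<bar>T4\<bar> \<le> d\<^sup>2 * (64 * C * \<bar>\<epsilon>\<bar> ^ 3) / \<epsilon>\<^sup>2"
        by (simp add: T4_def divide_right_mono)
    qed
    also have "\<dots> = E \<epsilon>"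
    proof -
      have "\<bar>\<epsilon>\<bar> ^ 3 / \<epsilon>\<^sup>2 = \<bar>\<epsilon>\<bar>"
        using \<epsilon>(1) by (simp add: power3_eq_cube power2_eq_square field_simps)
      then have "d\<^sup>2 * (64 * C * \<bar>\<epsilon>\<bar> ^ 3) / \<epsilon>\<^sup>2 = 64 * C * d\<^sup>2 * \<bar>\<epsilon>\<bar>"
        by (simp add: times_divide_eq_right[symmetric] del: times_divide_eq_right)
      then show ?thesis by (simp add: E_def c_def \<sigma>_def)
    qed
    finally show "norm (apply_bcontfun (rotation_difference \<epsilon> (ridge_poly p z) - ridge_poly (gegenbauer_op CARD('n) p) z) x) \<le> E \<epsilon>"
      unfolding split real_norm_def .
  qed
  have "((\<lambda>\<epsilon>. rotation_difference \<epsilon> (ridge_poly p z) - ridge_poly (gegenbauer_op CARD('n) p) z) \<longlongrightarrow> 0) (at 0)"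
  proof (rule Lim_null_comparison[OF _ E0])
    show "\<forall>\<^sub>F \<epsilon> in at 0. norm (rotation_difference \<epsilon> (ridge_poly p z) - ridge_poly (gegenbauer_op CARD('n) p) z) \<le> E \<epsilon>"
      unfolding eventually_at using main by (intro exI[of _ 1]) (auto simp: dist_real_def)
  qed
  then show ?thesis unfolding has_laplacian_def by (rule LIM_zero_cancel)
qed

section \<open>Gegenbauer polynomials\<close>

definition sphere_eigenvalue :: "nat \<Rightarrow> nat \<Rightarrow> real" where
  "sphere_eigenvalue d n = real n * (real n + real d - 2)"

lemma sphere_eigenvalue_strict_mono:
  assumes "d \<ge> 2" "m < n"
  shows "sphere_eigenvalue d m < sphere_eigenvalue d n"
proof -
  have "real m * (real m + (real d - 2)) \<le> real m * (real n + (real d - 2))"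
    using assms by (intro mult_left_mono) auto
  also have "\<dots> < real n * (real n + (real d - 2))"
    using assms by (intro mult_strict_right_mono) auto
  finally show ?thesis by (simp add: sphere_eigenvalue_def add_diff_eq)
qed

lemma sphere_eigenvalue_inj:
  assumes "d \<ge> 2" "sphere_eigenvalue d m = sphere_eigenvalue d n"
  shows "m = n"
  using sphere_eigenvalue_strict_mono[OF assms(1)] assms(2) by (metis less_irrefl nat_neq_iff)

text \<open>
  The coefficient of the \<open>l\<close>-th monic Gegenbauer polynomial in the expansion of the monomial of degree \<open>n\<close>. The
  recursion expresses that taking this coefficient turns the Laplacian into multiplication by minus the
  \<open>l\<close>-th eigenvalue. Defining the coefficients first, and the polynomials from them, makes the expansion hold by definition.
\<close>
fun gegenbauer_coeff :: "nat \<Rightarrow> nat \<Rightarrow> nat \<Rightarrow> real" where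
  "gegenbauer_coeff d l n =
     (if n < l then 0 else if n = l then 1
      else real n * (real n - 1) / (sphere_eigenvalue d n - sphere_eigenvalue d l) * gegenbauer_coeff d l (n - 2))"

declare gegenbauer_coeff.simps [simp del]

lemma gegenbauer_coeff_less: "n < l \<Longrightarrow> gegenbauer_coeff d l n = 0"
  and gegenbauer_coeff_self: "gegenbauer_coeff d l l = 1"
  by (simp_all add: gegenbauer_coeff.simps)

lemma gegenbauer_coeff_rec:
  assumes "d \<ge> 2"
  shows "real n * (real n - 1) * gegenbauer_coeff d l (n - 2)
       = (sphere_eigenvalue d n - sphere_eigenvalue d l) * gegenbauer_coeff d l n"
proof -
  consider "n < l" | "n = l" "n \<ge> 2" | "n = l" "n = 0 \<or> n = 1" | "l < n" by linarith
  then show ?thesis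
  proof cases
    case 4
    then have "sphere_eigenvalue d n \<noteq> sphere_eigenvalue d l"
      using sphere_eigenvalue_inj[OF assms] by blast
    then show ?thesis using 4 by (simp add: gegenbauer_coeff.simps[of d l n])
  qed (auto simp: gegenbauer_coeff_less gegenbauer_coeff_self)
qed

text \<open>
  The monic multiple of the classical Gegenbauer polynomial with parameter \<open>(d - 2) / 2\<close> if \<open>d > 2\<close>, and of the Chebyshev
  polynomial of the first kind if \<open>d = 2\<close>.
\<close>
fun gegenbauer :: "nat \<Rightarrow> nat \<Rightarrow> real poly" where
  "gegenbauer d n = monom 1 n - (\<Sum>l<n. smult (gegenbauer_coeff d l n) (gegenbauer d l))"

declare gegenbauer.simps [simp del]

lemma monom_eq_sum_gegenbauer:
  assumes "n \<le> N"
  shows "monom 1 n = (\<Sum>l\<le>N. smult (gegenbauer_coeff d l n) (gegenbauer d l))"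
proof -
  have "(\<Sum>l\<le>N. smult (gegenbauer_coeff d l n) (gegenbauer d l))
      = (\<Sum>l\<le>n. smult (gegenbauer_coeff d l n) (gegenbauer d l))"
    using assms by (intro sum.mono_neutral_right) (auto simp: gegenbauer_coeff_less)
  also have "{..n} = insert n {..<n}" by auto
  finally show ?thesis by (simp add: gegenbauer_coeff_self gegenbauer.simps[of d n])
qed

lemma gegenbauer_op_add: "gegenbauer_op d (p + q) = gegenbauer_op d p + gegenbauer_op d q"
  and gegenbauer_op_smult: "gegenbauer_op d (smult c p) = smult c (gegenbauer_op d p)"
  and gegenbauer_op_0: "gegenbauer_op d 0 = 0"
  unfolding gegenbauer_op_def
  by (simp_all add: pderiv_add pderiv_smult algebra_simps smult_add_right smult_diff_right)

lemma gegenbauer_op_sum: "gegenbauer_op d (\<Sum>i\<in>I. p i) = (\<Sum>i\<in>I. gegenbauer_op d (p i))"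
  by (induction I rule: infinite_finite_induct) (simp_all add: gegenbauer_op_0 gegenbauer_op_add)

lemma coeff_gegenbauer_op:
  "coeff (gegenbauer_op d p) n
     = (real n + 2) * (real n + 1) * coeff p (Suc (Suc n)) - sphere_eigenvalue d n * coeff p n"
proof -
  have eq: "coeff (gegenbauer_op d p) n = coeff (pderiv (pderiv p)) n
      + coeff (pCons 0 (pCons 0 (- pderiv (pderiv p)))) n - coeff (pCons 0 (smult (real d - 1) (pderiv p))) n"
    unfolding gegenbauer_op_def by simp
  consider "n = 0" | "n = Suc 0" | m where "n = Suc (Suc m)"
    by (cases n; cases "n - 1") auto
  then show ?thesis
    unfolding eq by cases (simp_all only: coeff_pCons_0 coeff_pCons_Suc coeff_pderiv coeff_minus coeff_smult sphere_eigenvalue_def, simp_all add: algebra_simps)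
qed

lemma gegenbauer_op_monom:
  "gegenbauer_op d (monom 1 n)
     = smult (real n * (real n - 1)) (monom 1 (n - 2)) - smult (sphere_eigenvalue d n) (monom 1 n)"
proof (rule poly_eqI)
  fix k
  consider "n = 0" | "n = 1" | m where "n = Suc (Suc m)"
    by (cases n; cases "n - 1") auto
  then show "coeff (gegenbauer_op d (monom 1 n)) k
      = coeff (smult (real n * (real n - 1)) (monom 1 (n - 2)) - smult (sphere_eigenvalue d n) (monom 1 n)) k"
    by cases (auto simp: coeff_gegenbauer_op sphere_eigenvalue_def algebra_simps)
qed

lemma smult_sum_distrib: "smult c (\<Sum>i\<in>I. p i) = (\<Sum>i\<in>I. smult c (p i))"
  by (induction I rule: infinite_finite_induct) (simp_all add: smult_add_right)

text \<open>
  Expand the Laplacian of the monomial of degree \<open>n\<close> in two ways: by its explicit formula together with the recursion for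
  the coefficients, and by linearity with the induction hypothesis. All terms of lower degree agree.
\<close>
lemma gegenbauer_op_gegenbauer:
  assumes "d \<ge> 2"
  shows "gegenbauer_op d (gegenbauer d n) = smult (- sphere_eigenvalue d n) (gegenbauer d n)"
proof (induction n rule: less_induct)
  case (less n)
  have "{..n} = insert n {..<n}" by auto
  then have split: "(\<Sum>l\<le>n. f l) = f n + (\<Sum>l<n. f l)" for f :: "nat \<Rightarrow> real poly" by simp
  have "gegenbauer_op d (monom 1 n)
      = smult (real n * (real n - 1)) (\<Sum>l\<le>n. smult (gegenbauer_coeff d l (n - 2)) (gegenbauer d l))
        - smult (sphere_eigenvalue d n) (\<Sum>l\<le>n. smult (gegenbauer_coeff d l n) (gegenbauer d l))"
    unfolding gegenbauer_op_monom
    using monom_eq_sum_gegenbauer[of "n - 2" n d] monom_eq_sum_gegenbauer[of n n d] by simp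
  also have "\<dots> = (\<Sum>l\<le>n. smult (real n * (real n - 1) * gegenbauer_coeff d l (n - 2)
        - sphere_eigenvalue d n * gegenbauer_coeff d l n) (gegenbauer d l))"
    by (simp add: smult_sum_distrib sum_subtractf smult_diff_left)
  also have "\<dots> = (\<Sum>l\<le>n. smult (- sphere_eigenvalue d l * gegenbauer_coeff d l n) (gegenbauer d l))"
    unfolding gegenbauer_coeff_rec[OF assms] by (simp add: algebra_simps)
  finally have 1: "gegenbauer_op d (monom 1 n) = smult (- sphere_eigenvalue d n) (gegenbauer d n)
      + (\<Sum>l<n. smult (- sphere_eigenvalue d l * gegenbauer_coeff d l n) (gegenbauer d l))"
    unfolding split by (simp add: gegenbauer_coeff_self)
  have "gegenbauer_op d (monom 1 n) = (\<Sum>l\<le>n. smult (gegenbauer_coeff d l n) (gegenbauer_op d (gegenbauer d l)))"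
    by (subst monom_eq_sum_gegenbauer[of n n d]) (simp_all add: gegenbauer_op_sum gegenbauer_op_smult)
  also have "\<dots> = gegenbauer_op d (gegenbauer d n)
      + (\<Sum>l<n. smult (- sphere_eigenvalue d l * gegenbauer_coeff d l n) (gegenbauer d l))"
    unfolding split using less by (simp add: gegenbauer_coeff_self mult.commute)
  finally show ?case using 1 by simp
qed

lemma has_laplacian_gegenbauer:
  fixes y :: "'n::finite unit_sphere"
  assumes "CARD('n) \<ge> 2"
  shows "has_laplacian (ridge_poly (gegenbauer CARD('n) l) (point_of y))
     (- sphere_eigenvalue CARD('n) l *\<^sub>R ridge_poly (gegenbauer CARD('n) l) (point_of y))"
  using has_laplacian_ridge_poly[of "point_of y" "gegenbauer CARD('n) l"]
  by (simp add: gegenbauer_op_gegenbauer[OF assms] ridge_poly_smult[symmetric])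

text \<open>
  On polynomials of degree at most \<open>m\<close> the Laplacian acts on the leading coefficient as multiplication by
  minus the \<open>m\<close>-th eigenvalue.
\<close>
lemma laplacian_lowers_degree:
  fixes p :: "'n::finite unit_sphere \<Rightarrow>\<^sub>C real"
  assumes "p \<in> span (ridge_polys_below (Suc m))"
  shows "\<exists>w. has_laplacian p w \<and> w + sphere_eigenvalue CARD('n) m *\<^sub>R p \<in> span (ridge_polys_below m)"
  using assms
proof (induction p rule: span_induct_alt)
  case base
  show ?case by (intro exI[of _ 0]) (simp add: has_laplacian_0 span_zero)
next
  case (step c u v)
  let ?\<nu> = "sphere_eigenvalue CARD('n) m"
  obtain q y where u: "u = ridge_poly q (point_of y)" and q: "\<forall>n\<ge>Suc m. coeff q n = 0"
    using step(1) unfolding ridge_polys_below_def by blast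
  define u' where "u' = ridge_poly (gegenbauer_op CARD('n) q) (point_of y)"
  have lap: "has_laplacian u u'" unfolding u u'_def by (rule has_laplacian_ridge_poly) simp
  have "u' + ?\<nu> *\<^sub>R u = ridge_poly (gegenbauer_op CARD('n) q + smult ?\<nu> q) (point_of y)"
    by (simp add: u u'_def ridge_poly_add ridge_poly_smult)
  moreover have "coeff (gegenbauer_op CARD('n) q + smult ?\<nu> q) n = 0" if "n \<ge> m" for n
    using that q by (cases "n = m") (simp_all add: coeff_gegenbauer_op)
  ultimately have u'_mem: "u' + ?\<nu> *\<^sub>R u \<in> span (ridge_polys_below m)"
    unfolding ridge_polys_below_def by (intro span_base) auto
  obtain v' where v': "has_laplacian v v'" "v' + ?\<nu> *\<^sub>R v \<in> span (ridge_polys_below m)"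
    using step by blast
  have "(c *\<^sub>R u' + v') + ?\<nu> *\<^sub>R (c *\<^sub>R u + v) = c *\<^sub>R (u' + ?\<nu> *\<^sub>R u) + (v' + ?\<nu> *\<^sub>R v)"
    by (simp add: algebra_simps)
  then have "(c *\<^sub>R u' + v') + ?\<nu> *\<^sub>R (c *\<^sub>R u + v) \<in> span (ridge_polys_below m)"
    using v'(2) u'_mem by (simp only: span_add span_scale)
  then show ?case
    using lap v'(1) by (intro exI[of _ "c *\<^sub>R u' + v'"] conjI has_laplacian_add has_laplacian_scale)
qed

text \<open>
  Applying the Laplacian plus the eigenvalues of degree \<open>m - 1, \<dots>, 0\<close> annihilates \<open>p\<close>, stays in \<open>V\<close>, and multiplies the
  Gegenbauer term by nonzero factors because \<open>m \<le> l\<close>.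
\<close>
lemma gegenbauer_mem_of_add_low_degree:
  fixes V :: "('n::finite unit_sphere \<Rightarrow>\<^sub>C real) set"
  assumes d: "CARD('n) \<ge> 2" and V: "closed V" "subspace V" "rotation_invariant V"
    and "m \<le> l" "c \<noteq> 0" "p \<in> span (ridge_polys_below m)"
    and "c *\<^sub>R ridge_poly (gegenbauer CARD('n) l) (point_of y) + p \<in> V"
  shows "ridge_poly (gegenbauer CARD('n) l) (point_of y) \<in> V"
  using assms(5-8)
proof (induction m arbitrary: c p)
  case 0
  have "ridge_polys_below 0 \<subseteq> {0 :: 'n unit_sphere \<Rightarrow>\<^sub>C real}"
    unfolding ridge_polys_below_def
    by (auto simp: poly_eq_iff ridge_poly_0 intro!: bcontfun_eqI)
       (metis coeff_0 poly_0 poly_eqI)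
  then have "span (ridge_polys_below 0) \<subseteq> {0 :: 'n unit_sphere \<Rightarrow>\<^sub>C real}"
    by (metis span_mono span_insert_0 span_empty)
  then have "p = 0" using 0 by blast
  then have "(1 / c) *\<^sub>R (c *\<^sub>R ridge_poly (gegenbauer CARD('n) l) (point_of y)) \<in> V"
    using 0 by (intro subspace_scale[OF V(2), of "c *\<^sub>R _"]) simp
  then show ?case using 0 by simp
next
  case (Suc m)
  let ?G = "ridge_poly (gegenbauer CARD('n) l) (point_of y)"
  let ?\<nu> = "sphere_eigenvalue CARD('n)"
  obtain w where w: "has_laplacian p w" "w + ?\<nu> m *\<^sub>R p \<in> span (ridge_polys_below m)"
    using laplacian_lowers_degree[OF Suc.prems(3)] by blast
  have "c *\<^sub>R (- ?\<nu> l *\<^sub>R ?G) + w \<in> V"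
    by (rule has_laplacian_mem[OF V Suc.prems(4)])
       (intro has_laplacian_add has_laplacian_scale has_laplacian_gegenbauer d w)
  then have "(c *\<^sub>R (- ?\<nu> l *\<^sub>R ?G) + w) + ?\<nu> m *\<^sub>R (c *\<^sub>R ?G + p) \<in> V"
    by (rule subspace_add[OF V(2) _ subspace_scale[OF V(2) Suc.prems(4)]])
  also have "(c *\<^sub>R (- ?\<nu> l *\<^sub>R ?G) + w) + ?\<nu> m *\<^sub>R (c *\<^sub>R ?G + p)
      = (c * (?\<nu> m - ?\<nu> l)) *\<^sub>R ?G + (w + ?\<nu> m *\<^sub>R p)"
    by (simp add: algebra_simps)
  finally show ?case
    using Suc.prems w(2) sphere_eigenvalue_strict_mono[OF d, of m l] by (intro Suc.IH) auto
qed

text \<open>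
  Eigenvectors for distinct eigenvalues are separated by an invariant subspace: the Laplacian plus the \<open>i\<close>-th
  eigenvalue removes the \<open>i\<close>-th summand and rescales the others by nonzero factors.
\<close>
lemma gegenbauer_mem_of_sum:
  fixes V :: "('n::finite unit_sphere \<Rightarrow>\<^sub>C real) set"
  assumes d: "CARD('n) \<ge> 2" and V: "closed V" "subspace V" "rotation_invariant V"
    and "finite I" "(\<Sum>l\<in>I. c l *\<^sub>R ridge_poly (gegenbauer CARD('n) l) (point_of y)) \<in> V" "l \<in> I" "c l \<noteq> 0"
  shows "ridge_poly (gegenbauer CARD('n) l) (point_of y) \<in> V"
  using assms(5-8)
proof (induction I arbitrary: c l)
  case (insert i I)
  define G where "G l = ridge_poly (gegenbauer CARD('n) l) (point_of y)" for l
  let ?\<nu> = "sphere_eigenvalue CARD('n)"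
  have lap: "has_laplacian (\<Sum>l\<in>J. c l *\<^sub>R G l) (\<Sum>l\<in>J. c l *\<^sub>R (- ?\<nu> l *\<^sub>R G l))" if "finite J" for J
    using that
  proof (induction J)
    case (insert k J)
    have "has_laplacian (c k *\<^sub>R G k) (c k *\<^sub>R (- ?\<nu> k *\<^sub>R G k))"
      unfolding G_def by (intro has_laplacian_scale has_laplacian_gegenbauer d)
    then show ?case
      unfolding sum.insert[OF insert.hyps(1,2)] by (rule has_laplacian_add[OF _ insert.IH])
  qed (simp add: has_laplacian_0)
  have u: "(\<Sum>l\<in>insert i I. c l *\<^sub>R G l) \<in> V" using insert.prems(1) by (simp only: G_def)
  then have "(\<Sum>l\<in>insert i I. c l *\<^sub>R (- ?\<nu> l *\<^sub>R G l)) \<in> V"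
    by (rule has_laplacian_mem[OF V]) (intro lap finite.insertI insert.hyps)
  then have "(\<Sum>l\<in>insert i I. c l *\<^sub>R (- ?\<nu> l *\<^sub>R G l)) + ?\<nu> i *\<^sub>R (\<Sum>l\<in>insert i I. c l *\<^sub>R G l) \<in> V"
    by (rule subspace_add[OF V(2) _ subspace_scale[OF V(2) u]])
  also have "(\<Sum>l\<in>insert i I. c l *\<^sub>R (- ?\<nu> l *\<^sub>R G l)) + ?\<nu> i *\<^sub>R (\<Sum>l\<in>insert i I. c l *\<^sub>R G l) = (\<Sum>l\<in>I. ((?\<nu> i - ?\<nu> l) * c l) *\<^sub>R G l)"
    using insert.hyps
    by (simp add: scaleR_add_right scaleR_sum_right sum_negf[symmetric] sum.distrib[symmetric] algebra_simps)
  finally have rest: "(\<Sum>l\<in>I. ((?\<nu> i - ?\<nu> l) * c l) *\<^sub>R G l) \<in> V" .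
  have mem: "G k \<in> V" if k: "k \<in> I" "c k \<noteq> 0" for k
    unfolding G_def
  proof (rule insert.IH[of "\<lambda>l. (?\<nu> i - ?\<nu> l) * c l" k])
    have "k \<noteq> i" using k insert.hyps by auto
    then show "(?\<nu> i - ?\<nu> k) * c k \<noteq> 0"
      using k sphere_eigenvalue_inj[OF d, of i k] by auto
  qed (use rest k in \<open>simp_all add: G_def\<close>)
  show ?case
  proof (cases "l = i")
    case True
    have "(\<Sum>k\<in>I. c k *\<^sub>R G k) \<in> V"
      using mem by (intro subspace_sum[OF V(2)]) (metis scaleR_zero_left subspace_0[OF V(2)] subspace_scale[OF V(2)])
    then have "(\<Sum>l\<in>insert i I. c l *\<^sub>R G l) - (\<Sum>k\<in>I. c k *\<^sub>R G k) \<in> V"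
      using u by (intro subspace_diff[OF V(2)])
    then have "(1 / c i) *\<^sub>R (c i *\<^sub>R G i) \<in> V"
      using insert.hyps by (intro subspace_scale[OF V(2), of "c i *\<^sub>R _"]) simp
    then show ?thesis using insert.prems True by (simp add: G_def)
  next
    case False
    then show ?thesis using mem insert.prems by (simp add: G_def)
  qed
qed auto

section \<open>A density criterion for zonal functions\<close>

text \<open>
  The hypothesis \<open>low\<close> says that the \<open>l\<close>-th Gegenbauer coefficient of \<open>\<Sum>n. a n * t ^ n\<close> does not vanish. For
  degrees from \<open>M\<close> on, the sign condition takes its place, through the positive definiteness of the modified kernel.
\<close>
theorem zonal_span_dense_criterion:
  fixes a :: "nat \<Rightarrow> real"
  assumes d: "CARD('n::finite) \<ge> 2"
    and sum: "summable (\<lambda>n. \<bar>a n\<bar>)"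
    and sgn: "\<And>n. n \<ge> M \<Longrightarrow> 0 < \<sigma> * a n"
    and low: "\<And>l. l < M \<Longrightarrow> \<exists>c. c \<noteq> 0 \<and> (\<lambda>n. a n * gegenbauer_coeff CARD('n) l n) sums c"
  shows "closure (span (range (zonal a))) = (UNIV :: ('n unit_sphere \<Rightarrow>\<^sub>C real) set)"
proof -
  define V where "V = closure (span (range (zonal a :: 'n unit_sphere \<Rightarrow> _)))"
  have V: "closed V" "subspace V" "rotation_invariant V"
    unfolding V_def by (rule closed_closure subspace_closure_span rotation_invariant_zonal_span[OF sum])+
  have zonal_mem: "zonal a y \<in> V" for y
    unfolding V_def by (intro subsetD[OF closure_subset] span_base) auto
  \<comment> \<open>a kernel with positive coefficients that differs from \<open>\<sigma> * f\<close> by a polynomial of degree below \<open>M\<close>\<close>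
  define a' where "a' n = (if n < M then 1 else \<sigma> * a n)" for n
  define b where "b n = (if n < M then 1 - \<sigma> * a n else 0)" for n
  have a'_eq: "a' n = \<sigma> * a n + b n" for n by (simp add: a'_def b_def)
  have "summable (\<lambda>n. \<sigma> * a n)" using summable_rabs_cancel[OF sum] by (rule summable_mult)
  moreover have "summable b" by (rule summable_finite[of "{..<M}"]) (auto simp: b_def)
  ultimately have sum': "summable a'" unfolding a'_eq[abs_def] by (rule summable_add)
  have pos': "a' n > 0" for n using sgn by (simp add: a'_def)
  have full: "span (V \<union> ridge_polys_below M) = UNIV"
  proof -
    let ?W = "span (V \<union> ridge_polys_below M)"
    have "zonal a' y \<in> ?W" for y
    proof -
      have "(\<lambda>n. \<sigma> *\<^sub>R (a n *\<^sub>R ridge_power n (point_of y)) + b n *\<^sub>R ridge_power n (point_of y))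
          sums (\<sigma> *\<^sub>R zonal a y + (\<Sum>n<M. b n *\<^sub>R ridge_power n (point_of y)))"
        by (intro sums_add sums_scaleR_right sums_zonal sum sums_finite) (auto simp: b_def)
      moreover have "summable (\<lambda>n. \<bar>a' n\<bar>)" using sum' pos' by (simp add: less_imp_le)
      ultimately have "zonal a' y = \<sigma> *\<^sub>R zonal a y + (\<Sum>n<M. b n *\<^sub>R ridge_power n (point_of y))"
        using sums_zonal[of a' y] by (simp add: a'_eq scaleR_add_left sums_unique2)
      moreover have "ridge_power n (point_of y) \<in> ridge_polys_below M" if "n < M" for n
        unfolding ridge_polys_below_def using that by (auto intro!: exI)
      ultimately show ?thesis
        using zonal_mem by (auto intro!: span_add span_scale span_sum intro: span_base)
    qed
    then have "closure (span (range (zonal a'))) \<subseteq> ?W"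
      by (intro closure_minimal span_minimal closed_span_Un_ridge_polys_below V) auto
    then show ?thesis using positive_zonal_span_dense[OF sum' pos'] by auto
  qed
  define G where "G l y = ridge_poly (gegenbauer CARD('n) l) (point_of y)" for l and y :: "'n unit_sphere"
  have high: "G l y \<in> V" if "l \<ge> M" for l y
  proof -
    have "G l y \<in> span (V \<union> ridge_polys_below M)" using full by auto
    then obtain v p where "v \<in> V" "p \<in> span (ridge_polys_below M)" "G l y = v + p"
      unfolding span_Un using V(2) by (auto simp: span_eq_iff[THEN iffD2])
    then show ?thesis
      unfolding G_def
      by (intro gegenbauer_mem_of_add_low_degree[OF d V that, of 1 "- p"]) (auto simp: span_neg)
  qed
  obtain lam where lam: "\<And>l. l < M \<Longrightarrow> lam l \<noteq> 0"
      "\<And>l. l < M \<Longrightarrow> (\<lambda>n. a n * gegenbauer_coeff CARD('n) l n) sums lam l"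
    using low by metis
  \<comment> \<open>the partial sums of \<open>f\<close>, minus their components of degree below \<open>M\<close>, lie in \<open>V\<close>\<close>
  have low_sum: "(\<Sum>l<M. lam l *\<^sub>R G l y) \<in> V" for y
  proof -
    define D where "D N = (\<Sum>n<N. a n *\<^sub>R ridge_power n (point_of y))
      - (\<Sum>l<M. (\<Sum>n<N. a n * gegenbauer_coeff CARD('n) l n) *\<^sub>R G l y)" for N
    have "D \<longlonglongrightarrow> zonal a y - (\<Sum>l<M. lam l *\<^sub>R G l y)"
      unfolding D_def using sums_zonal[OF sum, of y] lam(2)
      by (intro tendsto_intros) (auto simp: sums_def)
    moreover have "D N \<in> V" if "N \<ge> M" for N
    proof -
      have "ridge_power n (point_of y) = (\<Sum>l<N. gegenbauer_coeff CARD('n) l n *\<^sub>R G l y)" if "n < N" for n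
      proof -
        have "monom 1 n = (\<Sum>l\<le>N - 1. smult (gegenbauer_coeff CARD('n) l n) (gegenbauer CARD('n) l))"
          using that by (intro monom_eq_sum_gegenbauer) auto
        also have "{..N - 1} = {..<N}" using that by auto
        finally show ?thesis by (simp add: ridge_poly_sum ridge_poly_smult G_def)
      qed
      then have "(\<Sum>n<N. a n *\<^sub>R ridge_power n (point_of y))
          = (\<Sum>n<N. \<Sum>l<N. (a n * gegenbauer_coeff CARD('n) l n) *\<^sub>R G l y)"
        by (simp add: scaleR_sum_right)
      also have "\<dots> = (\<Sum>l<N. (\<Sum>n<N. a n * gegenbauer_coeff CARD('n) l n) *\<^sub>R G l y)"
        by (subst sum.swap) (simp add: scaleR_sum_left)
      also have "\<dots> = (\<Sum>l<M. (\<Sum>n<N. a n * gegenbauer_coeff CARD('n) l n) *\<^sub>R G l y)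
          + (\<Sum>l\<in>{M..<N}. (\<Sum>n<N. a n * gegenbauer_coeff CARD('n) l n) *\<^sub>R G l y)"
        using that unfolding lessThan_atLeast0 by (intro sum.atLeastLessThan_concat[symmetric]) auto
      finally have "D N = (\<Sum>l\<in>{M..<N}. (\<Sum>n<N. a n * gegenbauer_coeff CARD('n) l n) *\<^sub>R G l y)"
        unfolding D_def by (simp only: add_diff_cancel_left')
      then show ?thesis
        using high by (auto intro!: subspace_sum[OF V(2)] subspace_scale[OF V(2)])
    qed
    ultimately have "zonal a y - (\<Sum>l<M. lam l *\<^sub>R G l y) \<in> V"
      by (intro Lim_in_closed_set[OF V(1) _ trivial_limit_sequentially])
         (auto simp: eventually_sequentially)
    then have "zonal a y - (zonal a y - (\<Sum>l<M. lam l *\<^sub>R G l y)) \<in> V"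
      by (rule subspace_diff[OF V(2) zonal_mem])
    then show ?thesis by simp
  qed
  have all: "G l y \<in> V" for l y
  proof (cases "l < M")
    case True
    then show ?thesis
      using low_sum[of y] lam(1)[of l] unfolding G_def
      by (intro gegenbauer_mem_of_sum[OF d V, of "{..<M}" lam]) auto
  qed (use high in auto)
  have power_mem: "ridge_power n (point_of y) \<in> V" for n y
    unfolding monom_eq_sum_gegenbauer[of n n "CARD('n)", OF order_refl] ridge_poly_sum ridge_poly_smult
    by (intro subspace_sum[OF V(2)] subspace_scale[OF V(2)] all[unfolded G_def])
  have "ridge_polys_below M \<subseteq> V"
  proof
    fix u :: "'n unit_sphere \<Rightarrow>\<^sub>C real" assume "u \<in> ridge_polys_below M"
    then obtain p y where u: "u = ridge_poly p (point_of y)" "\<forall>n\<ge>M. coeff p n = 0"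
      unfolding ridge_polys_below_def by blast
    show "u \<in> V"
      unfolding u(1) ridge_poly_eq_sum_powers[OF u(2)]
      by (intro subspace_sum[OF V(2)] subspace_scale[OF V(2)] power_mem)
  qed
  then have "V \<union> ridge_polys_below M = V" by auto
  then have "span V = UNIV" using full by simp
  then show ?thesis using V(2) unfolding V_def by (simp add: span_eq_iff[THEN iffD2])
qed

section \<open>Means of power series over spheres\<close>

unbundle no vec_syntax and fps_syntax

text \<open>
  The mean of the \<open>2 * j\<close>-th power of one coordinate over the unit sphere of \<open>D\<close>-dimensional space. Odd
  powers have mean zero, so \<open>sphere_mean_sums D F c\<close> below says that the power series \<open>F\<close> in one coordinate has
  mean \<open>c\<close>.
\<close>
definition sphere_moment :: "nat \<Rightarrow> nat \<Rightarrow> real" where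
  "sphere_moment D j = (\<Prod>i<j. (2 * real i + 1) / (real D + 2 * real i))"

lemma sphere_moment_0 [simp]: "sphere_moment D 0 = 1"
  by (simp add: sphere_moment_def)

lemma sphere_moment_Suc:
  "sphere_moment D (Suc j) = sphere_moment D j * ((2 * real j + 1) / (real D + 2 * real j))"
  by (simp add: sphere_moment_def)

lemma sphere_moment_pos: "D \<ge> 1 \<Longrightarrow> sphere_moment D j > 0"
  unfolding sphere_moment_def by (intro prod_pos) auto

lemma sphere_moment_le_1: "D \<ge> 1 \<Longrightarrow> sphere_moment D j \<le> 1"
  unfolding sphere_moment_def by (intro prod_le_1) (auto simp: divide_le_eq_1)

definition sphere_mean_sums :: "nat \<Rightarrow> real fps \<Rightarrow> real \<Rightarrow> bool" where
  "sphere_mean_sums D F c \<longleftrightarrow> (\<lambda>j. sphere_moment D j * F $ (2 * j)) sums c"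

lemma sphere_mean_sums_add: "sphere_mean_sums D F c \<Longrightarrow> sphere_mean_sums D F' c' \<Longrightarrow> sphere_mean_sums D (F + F') (c + c')"
  and sphere_mean_sums_cmult: "sphere_mean_sums D F c \<Longrightarrow> sphere_mean_sums D (fps_const k * F) (k * c)"
  unfolding sphere_mean_sums_def
  using sums_add[of "\<lambda>j. sphere_moment D j * F $ (2 * j)" c "\<lambda>j. sphere_moment D j * F' $ (2 * j)" c']
    sums_mult[of "\<lambda>j. sphere_moment D j * F $ (2 * j)" c k]
  by (simp_all add: algebra_simps)

lemma summable_even_coeffs:
  assumes "summable (\<lambda>n. \<bar>F $ n\<bar> :: real)"
  shows "summable (\<lambda>j. \<bar>F $ (2 * j)\<bar>)"
  using summable_reindex[OF assms, of "\<lambda>j. 2 * j"] by (simp add: comp_def inj_on_def)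

lemma ex_sphere_mean_sums:
  assumes "D \<ge> 1" "summable (\<lambda>n. \<bar>F $ n\<bar>)"
  shows "\<exists>c. sphere_mean_sums D F c"
proof -
  have "summable (\<lambda>j. sphere_moment D j * F $ (2 * j))"
  proof (rule summable_comparison_test'[OF summable_even_coeffs[OF assms(2)], of 0])
    show "norm (sphere_moment D j * F $ (2 * j)) \<le> \<bar>F $ (2 * j)\<bar>" for j
      using sphere_moment_le_1[OF assms(1), of j] sphere_moment_pos[OF assms(1), of j]
      by (simp add: abs_mult mult_left_le_one_le)
  qed
  then show ?thesis unfolding sphere_mean_sums_def summable_def .
qed

text \<open>
  The series is the divergence on the sphere of \<open>F\<close> times the gradient of the coordinate, so its mean vanishes. In terms of
  coefficients, the sum telescopes, and the hypothesis \<open>lim\<close> kills the boundary term.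
\<close>
lemma sphere_mean_divergence:
  assumes D: "D \<ge> 1" and lim: "(\<lambda>n. real n * F $ n) \<longlonglongrightarrow> 0"
  shows "sphere_mean_sums D ((1 - fps_X ^ 2) * fps_deriv F - fps_const (real D - 1) * (fps_X * F)) 0"
proof -
  let ?M = "(1 - fps_X ^ 2) * fps_deriv F - fps_const (real D - 1) * (fps_X * F)"
  have part: "(\<Sum>j<Suc J. sphere_moment D j * ?M $ (2 * j)) = sphere_moment D J * (real (2 * J + 1) * F $ (2 * J + 1))" for J
  proof (induction J)
    case 0
    show ?case by (simp add: left_diff_distrib)
  next
    case (Suc J)
    have M: "?M $ (2 * Suc J) = real (2 * J + 3) * F $ (2 * J + 3) - (real D + 2 * real J) * F $ (2 * J + 1)"
      by (simp add: left_diff_distrib fps_X_power_mult_nth numeral_3_eq_3) (simp add: algebra_simps)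
    have step: "sphere_moment D (Suc J) * ((real D + 2 * real J) * F $ (2 * J + 1))
        = sphere_moment D J * (real (2 * J + 1) * F $ (2 * J + 1))"
      using D by (simp add: sphere_moment_Suc)
    show ?case
      unfolding sum.lessThan_Suc[of _ "Suc J"] Suc.IH M right_diff_distrib step
      by (simp add: numeral_3_eq_3)
  qed
  have odd: "filterlim (\<lambda>J. 2 * J + 1 :: nat) sequentially sequentially"
    by (rule filterlim_subseq) (simp add: strict_mono_def)
  have "(\<lambda>J. sphere_moment D J * (real (2 * J + 1) * F $ (2 * J + 1))) \<longlonglongrightarrow> 0"
  proof (rule Lim_null_comparison[OF always_eventually])
    show "\<forall>J. norm (sphere_moment D J * (real (2 * J + 1) * F $ (2 * J + 1))) \<le> \<bar>real (2 * J + 1) * F $ (2 * J + 1)\<bar>"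
    proof
      fix J
      show "norm (sphere_moment D J * (real (2 * J + 1) * F $ (2 * J + 1))) \<le> \<bar>real (2 * J + 1) * F $ (2 * J + 1)\<bar>"
        using sphere_moment_le_1[OF D, of J] sphere_moment_pos[OF D, of J]
        unfolding real_norm_def abs_mult[of "sphere_moment D J"]
        by (intro mult_left_le_one_le) auto
    qed
    show "(\<lambda>J. \<bar>real (2 * J + 1) * F $ (2 * J + 1)\<bar>) \<longlonglongrightarrow> 0"
      using filterlim_compose[OF lim odd] by (rule tendsto_rabs_zero)
  qed
  then have "(\<lambda>J. \<Sum>j<Suc J. sphere_moment D j * ?M $ (2 * j)) \<longlonglongrightarrow> 0"
    unfolding part .
  then show ?thesis unfolding sphere_mean_sums_def sums_def by (rule LIMSEQ_imp_Suc)
qed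

text \<open>
  For \<open>F = (1 - t)\<^sup>s\<close> the differential equation holds with \<open>E = 0\<close>, and for \<open>F = (1 - t)\<^sup>s * ln (2 - 2 * t)\<close> with \<open>E = (1 - t)\<^sup>s\<close>. Substituting
  it into the vanishing divergence relates the means for the exponents \<open>s\<close> and \<open>s + 1\<close>.
\<close>
lemma sphere_mean_recurrence:
  assumes D: "D \<ge> 1" and lim: "(\<lambda>n. real n * F $ n) \<longlonglongrightarrow> 0"
    and ode: "(1 - fps_X) * fps_deriv F = - fps_const s * F - E"
    and F: "sphere_mean_sums D F c" "sphere_mean_sums D ((1 - fps_X) * F) c'"
    and E: "sphere_mean_sums D E e" "sphere_mean_sums D ((1 - fps_X) * E) e'"
  shows "(s + real D - 1) * c' = (2 * s + real D - 1) * c + 2 * e - e'"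
proof -
  have "(1 - fps_X ^ 2) * fps_deriv F - fps_const (real D - 1) * (fps_X * F)
      = (2 - (1 - fps_X)) * ((1 - fps_X) * fps_deriv F) - fps_const (real D - 1) * ((1 - (1 - fps_X)) * F)"
    by (simp add: algebra_simps power2_eq_square)
  also have "\<dots> = fps_const (s + real D - 1) * ((1 - fps_X) * F) + (fps_const (- (2 * s + real D - 1)) * F
      + (fps_const (- 2) * E + fps_const 1 * ((1 - fps_X) * E)))"
  proof -
    define X1 :: "real fps" where "X1 = 1 - fps_X"
    define u v where "u = fps_const s" and "v = fps_const (real D - 1)"
    have c: "fps_const (s + real D - 1) = u + v" "fps_const (- (2 * s + real D - 1)) = - (2 * u + v)"
      "fps_const (- 2 :: real) = - 2" "fps_const (1 :: real) = 1"
      by (simp_all add: fps_eq_iff fps_numeral_nth u_def v_def)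
    have "(2 - X1) * (- u * F - E) - v * ((1 - X1) * F)
        = (u + v) * (X1 * F) + (- (2 * u + v) * F + (- 2 * E + 1 * (X1 * E)))"
      by (simp add: algebra_simps)
    then show ?thesis
      unfolding c ode X1_def u_def[symmetric] v_def[symmetric] .
  qed
  finally have "sphere_mean_sums D (fps_const (s + real D - 1) * ((1 - fps_X) * F) + (fps_const (- (2 * s + real D - 1)) * F
      + (fps_const (- 2) * E + fps_const 1 * ((1 - fps_X) * E)))) 0"
    using sphere_mean_divergence[OF D lim] by simp
  moreover have "sphere_mean_sums D (fps_const (s + real D - 1) * ((1 - fps_X) * F) + (fps_const (- (2 * s + real D - 1)) * F
      + (fps_const (- 2) * E + fps_const 1 * ((1 - fps_X) * E))))
     ((s + real D - 1) * c' + (- (2 * s + real D - 1) * c + (- 2 * e + 1 * e')))"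
    by (intro sphere_mean_sums_add sphere_mean_sums_cmult F E)
  ultimately have "0 = (s + real D - 1) * c' + (- (2 * s + real D - 1) * c + (- 2 * e + 1 * e'))"
    unfolding sphere_mean_sums_def by (rule sums_unique2)
  then show ?thesis by (simp add: algebra_simps)
qed

text \<open>
  This identity behind \<open>gegenbauer_coeff_sums\<close> reflects that differentiating \<open>l\<close> times turns the zonal Laplacian in
  dimension \<open>d\<close> into the one in dimension \<open>d + 2 * l\<close>, shifted by the \<open>l\<close>-th eigenvalue.
\<close>
lemma gegenbauer_coeff_eq_moment:
  assumes d: "d \<ge> 2"
  shows "gegenbauer_coeff d l (l + 2 * j) = sphere_moment (d + 2 * l) j * (fact (l + 2 * j) / (fact (2 * j) * fact l))"
proof (induction j)
  case 0
  show ?case by (simp add: gegenbauer_coeff_self)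
next
  case (Suc j)
  define n where "n = l + 2 * j"
  have n2: "l + 2 * Suc j = Suc (Suc n)" by (simp add: n_def)
  have ev: "sphere_eigenvalue d (Suc (Suc n)) - sphere_eigenvalue d l
      = 2 * (real j + 1) * (real d + 2 * real l + 2 * real j)"
    by (simp add: sphere_eigenvalue_def n_def algebra_simps)
  have pos: "2 * (real j + 1) * (real d + 2 * real l + 2 * real j) > 0"
    using d by (intro mult_pos_pos) auto
  have "2 * (real j + 1) * (real d + 2 * real l + 2 * real j) * gegenbauer_coeff d l (l + 2 * Suc j)
      = (real n + 2) * (real n + 1) * gegenbauer_coeff d l n"
    using gegenbauer_coeff_rec[OF d, of "Suc (Suc n)" l] unfolding n2 ev by (simp add: algebra_simps)
  moreover have "(real n + 2) * (real n + 1) * gegenbauer_coeff d l n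
     = 2 * (real j + 1) * (real d + 2 * real l + 2 * real j) *
      (sphere_moment (d + 2 * l) (Suc j) * (fact (l + 2 * Suc j) / (fact (2 * Suc j) * fact l)))"
  proof -
    define K where "K = real d + 2 * real l + 2 * real j"
    have K: "K > 0" using d by (simp add: K_def)
    have f1: "fact (l + 2 * Suc j) = (real n + 2) * ((real n + 1) * fact n)"
      unfolding n2 by (simp add: algebra_simps)
    have f2: "fact (2 * Suc j) = (2 * real j + 2) * ((2 * real j + 1) * (fact (2 * j) :: real))"
      by (simp add: algebra_simps)
    have f3: "sphere_moment (d + 2 * l) (Suc j) = sphere_moment (d + 2 * l) j * ((2 * real j + 1) / K)"
      by (simp add: sphere_moment_Suc K_def)
    have "2 * real j + 1 \<noteq> 0" "2 * real j + 2 \<noteq> 0" by linarith+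
    then show ?thesis
      unfolding f1 f2 f3 K_def[symmetric] using K Suc.IH
      by (simp add: n_def[symmetric])
  qed
  ultimately have "2 * (real j + 1) * (real d + 2 * real l + 2 * real j) * gegenbauer_coeff d l (l + 2 * Suc j)
     = 2 * (real j + 1) * (real d + 2 * real l + 2 * real j) *
      (sphere_moment (d + 2 * l) (Suc j) * (fact (l + 2 * Suc j) / (fact (2 * Suc j) * fact l)))"
    by (rule trans)
  then show ?case using pos mult_left_cancel[OF less_imp_neq[OF pos, symmetric]] by blast
qed

lemma gegenbauer_coeff_odd: "d \<ge> 2 \<Longrightarrow> gegenbauer_coeff d l (l + 2 * j + 1) = 0"
proof (induction j)
  case 0
  then show ?case
    using gegenbauer_coeff_rec[OF 0, of "l + 1" l] sphere_eigenvalue_strict_mono[OF 0, of l "l + 1"]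
    by (cases l) (auto simp: gegenbauer_coeff_less)
next
  case (Suc j)
  have "sphere_eigenvalue d l < sphere_eigenvalue d (l + 2 * Suc j + 1)"
    using Suc.prems by (intro sphere_eigenvalue_strict_mono) auto
  then show ?case
    using gegenbauer_coeff_rec[OF Suc.prems, of "l + 2 * Suc j + 1" l] Suc by auto
qed

lemma fps_nth_iterated_deriv:
  "((fps_deriv ^^ l) F) $ n = (fact (n + l) / fact n) * (F $ (n + l) :: real)"
proof (induction l arbitrary: n)
  case (Suc l)
  show ?case by (simp add: Suc.IH field_simps del: of_nat_Suc)
qed simp

lemma gegenbauer_coeff_sums:
  assumes d: "d \<ge> 2" and h: "sphere_mean_sums (d + 2 * l) ((fps_deriv ^^ l) F) h"
  shows "(\<lambda>n. F $ n * gegenbauer_coeff d l n) sums (h / fact l)"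
proof -
  have zero: "F $ n * gegenbauer_coeff d l n = 0" if "n \<notin> range (\<lambda>j. l + 2 * j)" for n
  proof (cases "n < l")
    case False
    then obtain k where k: "n = l + k" using le_Suc_ex by (metis not_less)
    have "odd k"
    proof
      assume "even k"
      then obtain j where "k = 2 * j" by blast
      then show False using that k by auto
    qed
    then obtain j where "k = 2 * j + 1" by (rule oddE)
    then show ?thesis using gegenbauer_coeff_odd[OF d, of l j] k by simp
  qed (simp add: gegenbauer_coeff_less)
  have "(\<lambda>j. (1 / fact l) * (sphere_moment (d + 2 * l) j * ((fps_deriv ^^ l) F) $ (2 * j))) sums ((1 / fact l) * h)"
    using h unfolding sphere_mean_sums_def by (rule sums_mult)
  moreover have "(1 / fact l) * (sphere_moment (d + 2 * l) j * ((fps_deriv ^^ l) F) $ (2 * j))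
      = F $ (l + 2 * j) * gegenbauer_coeff d l (l + 2 * j)" for j
    unfolding gegenbauer_coeff_eq_moment[OF d] fps_nth_iterated_deriv by (simp add: add.commute mult_ac)
  ultimately have "(\<lambda>j. F $ (l + 2 * j) * gegenbauer_coeff d l (l + 2 * j)) sums (h / fact l)" by simp
  then show ?thesis
    by (subst (asm) sums_mono_reindex[of "\<lambda>j. l + 2 * j"]) (auto simp: strict_mono_def zero)
qed

section \<open>Power series up to the endpoints of the interval of convergence\<close>

text \<open>
  From index \<open>M\<close> on the terms of the series at \<open>t \<in> {0<..<1}\<close> have one sign, so their partial sums are bounded in terms of
  the bound for \<open>f\<close>. Letting \<open>t\<close> tend to 1 bounds the partial sums of the coefficients themselves. Absolute
  convergence makes the sum continuous on the closed interval, so the identity extends to the endpoints.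
\<close>
lemma power_series_endpoints:
  fixes a :: "nat \<Rightarrow> real"
  assumes cont: "continuous_on {-1..1} f"
    and series: "\<And>t. \<bar>t\<bar> < 1 \<Longrightarrow> (\<lambda>n. a n * t ^ n) sums f t"
    and sgn: "\<And>n. n \<ge> M \<Longrightarrow> 0 \<le> \<sigma> * a n" and \<sigma>: "\<sigma> \<noteq> 0"
  shows "summable (\<lambda>n. \<bar>a n\<bar>)" and "\<And>t. \<bar>t\<bar> \<le> 1 \<Longrightarrow> (\<lambda>n. a n * t ^ n) sums f t"
proof -
  define b where "b n = (if n < M then 0 else \<sigma> * a n)" for n
  have b0: "b n \<ge> 0" for n using sgn by (simp add: b_def)
  have "bounded (f ` {-1..1})" by (intro compact_imp_bounded compact_continuous_image cont compact_Icc)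
  then obtain B where B: "B > 0" "\<forall>t\<in>{-1..1}. \<bar>f t\<bar> \<le> B" unfolding bounded_pos by auto
  define K where "K = \<bar>\<sigma>\<bar> * B + (\<Sum>n<M. \<bar>\<sigma> * a n\<bar>)"
  have interior: "(\<Sum>n<N. b n * t ^ n) \<le> K" if t: "0 < t" "t < 1" for N and t :: real
  proof -
    have "(\<lambda>n. \<sigma> * (a n * t ^ n) - (if n < M then \<sigma> * a n * t ^ n else 0)) sums (\<sigma> * f t - (\<Sum>n<M. \<sigma> * a n * t ^ n))"
      using t sums_If_finite_set[of "{..<M}" "\<lambda>n. \<sigma> * a n * t ^ n"]
      by (intro sums_diff sums_mult series) auto
    moreover have "\<sigma> * (a n * t ^ n) - (if n < M then \<sigma> * a n * t ^ n else 0) = b n * t ^ n" for n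
      by (simp add: b_def)
    ultimately have s: "(\<lambda>n. b n * t ^ n) sums (\<sigma> * f t - (\<Sum>n<M. \<sigma> * a n * t ^ n))" by simp
    have "(\<Sum>n<N. b n * t ^ n) \<le> \<sigma> * f t - (\<Sum>n<M. \<sigma> * a n * t ^ n)"
      using s b0 t sum_le_suminf[of "\<lambda>n. b n * t ^ n" "{..<N}"] by (auto simp: sums_iff)
    also have "\<dots> \<le> \<bar>\<sigma> * f t\<bar> + \<bar>\<Sum>n<M. \<sigma> * a n * t ^ n\<bar>" by linarith
    also have "\<bar>\<Sum>n<M. \<sigma> * a n * t ^ n\<bar> \<le> (\<Sum>n<M. \<bar>\<sigma> * a n\<bar>)"
    proof (rule order_trans[OF sum_abs sum_mono])
      fix n
      show "\<bar>\<sigma> * a n * t ^ n\<bar> \<le> \<bar>\<sigma> * a n\<bar>"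
        using t by (simp add: abs_mult power_le_one mult_left_le)
    qed
    also have "\<bar>\<sigma> * f t\<bar> \<le> \<bar>\<sigma>\<bar> * B" using B(2) t by (simp add: abs_mult mult_left_mono)
    finally show ?thesis by (simp add: K_def)
  qed
  have "summable b"
  proof (rule summableI_nonneg_bounded[OF b0])
    fix N
    have lim: "((\<lambda>t. \<Sum>n<N. b n * t ^ n) \<longlongrightarrow> (\<Sum>n<N. b n * 1 ^ n)) (at_left (1::real))"
      by (intro tendsto_intros)
    have "\<forall>\<^sub>F t in at_left (1::real). (\<Sum>n<N. b n * t ^ n) \<le> K"
      using eventually_at_left_real[OF zero_less_one] by (rule eventually_mono) (auto intro: interior)
    then show "(\<Sum>n<N. b n) \<le> K"
      using tendsto_upperbound[OF lim] by simp
  qed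
  then have "summable (\<lambda>n. b n / \<bar>\<sigma>\<bar>)" by (rule summable_divide)
  then show abs: "summable (\<lambda>n. \<bar>a n\<bar>)"
  proof (rule summable_comparison_test'[of _ M])
    fix n assume n: "n \<ge> M"
    have "b n = \<bar>\<sigma>\<bar> * \<bar>a n\<bar>"
      using n sgn[OF n] by (simp add: b_def abs_mult[symmetric])
    then show "norm \<bar>a n\<bar> \<le> b n / \<bar>\<sigma>\<bar>" using \<sigma> by simp
  qed
  define g where "g t = (\<Sum>n. a n * t ^ n)" for t
  have bound: "norm (a n * t ^ n) \<le> \<bar>a n\<bar>" if "t \<in> {-1..1}" for n and t :: real
    using that by (auto simp: abs_mult power_abs abs_le_iff intro!: mult_left_le power_le_one)
  have "uniform_limit {-1..1} (\<lambda>N t. \<Sum>n<N. a n * t ^ n) g sequentially"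
    unfolding g_def using bound by (intro Weierstrass_m_test[OF _ abs]) auto
  then have "continuous_on {-1..1} g"
    by (rule uniform_limit_theorem[rotated]) (auto intro!: always_eventually continuous_intros)
  then have cl: "continuous_on (closure {-1<..<1}) (\<lambda>t. g t - f t)"
    using cont continuous_on_diff[of "{-1..1}" g f] by simp
  have zero: "g t - f t = 0" if "t \<in> {-1<..<1}" for t
    using sums_unique[OF series[of t]] that by (simp add: g_def abs_less_iff)
  have eq: "g t - f t = 0" if "t \<in> {-1..1}" for t
    by (rule continuous_constant_on_closure[OF cl zero]) (use that in simp_all)
  fix t :: real assume t: "\<bar>t\<bar> \<le> 1"
  then have mem: "t \<in> {-1..1}" by auto
  then have "summable (\<lambda>n. a n * t ^ n)"
    by (intro summable_comparison_test'[OF abs, of 0] bound)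
  then show "(\<lambda>n. a n * t ^ n) sums f t"
    using eq[OF mem] by (simp add: g_def sums_iff)
qed

section \<open>The Taylor coefficients of powers and logarithms\<close>

definition one_minus_powr :: "real \<Rightarrow> real fps" where
  "one_minus_powr s = Abs_fps (\<lambda>n. (-1) ^ n * (s gchoose n))"

text \<open>
  The series of \<open>ln (2 - 2 * t)\<close>.
\<close>
definition log_series :: "real fps" where
  "log_series = Abs_fps (\<lambda>n. if n = 0 then ln 2 else - 1 / real n)"

text \<open>
  The series of \<open>(1 - t) ^ j * ln (2 - 2 * t)\<close>. The factor 2 inside the logarithm comes from
  \<open>2 - 2 * t = (norm (x - y))\<^sup>2\<close>; a different factor would change the Gegenbauer coefficients of degree at most \<open>j\<close>.
\<close>
definition log_power :: "nat \<Rightarrow> real fps" where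
  "log_power j = (1 - fps_X) ^ j * log_series"

lemma one_minus_powr_nth_0 [simp]: "one_minus_powr s $ 0 = 1"
  by (simp add: one_minus_powr_def)

lemma one_minus_X_mult_nth: "((1 - fps_X) * F) $ n = F $ n - (if n = 0 then 0 else F $ (n - 1))" for F :: "real fps"
  by (simp add: left_diff_distrib)

lemma one_minus_powr_Suc: "one_minus_powr (s + 1) = (1 - fps_X) * one_minus_powr s"
proof (rule fps_ext)
  fix n
  show "one_minus_powr (s + 1) $ n = ((1 - fps_X) * one_minus_powr s) $ n"
    by (cases n) (simp_all add: one_minus_X_mult_nth one_minus_powr_def gbinomial_Suc_Suc ring_distribs)
qed

lemma fps_deriv_one_minus_powr: "fps_deriv (one_minus_powr s) = fps_const (- s) * one_minus_powr (s - 1)"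
proof (rule fps_ext)
  fix n
  have "real (Suc n) * (s gchoose Suc n) = s * ((s - 1) gchoose n)"
    by (rule gbinomial_absorption)
  then have "(-1) ^ Suc n * (real (Suc n) * (s gchoose Suc n)) = (-1) ^ Suc n * (s * ((s - 1) gchoose n))"
    by (simp only:)
  then show "fps_deriv (one_minus_powr s) $ n = (fps_const (- s) * one_minus_powr (s - 1)) $ n"
    by (simp add: one_minus_powr_def algebra_simps)
qed

lemma one_minus_powr_ode: "(1 - fps_X) * fps_deriv (one_minus_powr s) = - fps_const s * one_minus_powr s"
proof -
  have "(1 - fps_X) * fps_deriv (one_minus_powr s) = fps_const (- s) * ((1 - fps_X) * one_minus_powr (s - 1))"
    unfolding fps_deriv_one_minus_powr by (simp only: mult.left_commute)
  also have "(1 - fps_X) * one_minus_powr (s - 1) = one_minus_powr s"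
    using one_minus_powr_Suc[of "s - 1"] by simp
  finally show ?thesis by (simp only: fps_const_neg)
qed

lemma one_minus_powr_0: "one_minus_powr 0 = 1"
  by (rule fps_ext) (simp add: one_minus_powr_def gbinomial_0_left)

lemma one_minus_powr_of_nat: "one_minus_powr (real j) = (1 - fps_X) ^ j"
proof (induction j)
  case (Suc j)
  have "one_minus_powr (real (Suc j)) = one_minus_powr (real j + 1)" by (simp add: add.commute)
  then show ?case by (simp only: one_minus_powr_Suc Suc.IH power_Suc)
qed (simp add: one_minus_powr_0)

lemma log_power_0: "log_power 0 = log_series"
  and log_power_Suc: "log_power (Suc j) = (1 - fps_X) * log_power j"
  by (simp_all add: log_power_def mult.assoc)

lemma log_series_ode: "(1 - fps_X) * fps_deriv log_series = - 1"
proof (rule fps_ext)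
  fix n
  show "((1 - fps_X) * fps_deriv log_series) $ n = (- 1) $ n"
    by (cases n) (simp_all add: one_minus_X_mult_nth log_series_def)
qed

lemma fps_deriv_log_power_Suc:
  "fps_deriv (log_power (Suc j)) = fps_const (- real (Suc j)) * (log_power j + fps_const (1 / real (Suc j)) * one_minus_powr (real j))"
proof -
  have "fps_deriv (log_power (Suc j)) = fps_deriv ((1 - fps_X) ^ Suc j) * log_series
      + (1 - fps_X) ^ j * ((1 - fps_X) * fps_deriv log_series)"
    unfolding log_power_def fps_deriv_mult by (simp add: algebra_simps)
  also have "fps_deriv ((1 - fps_X :: real fps) ^ Suc j) = fps_const (- real (Suc j)) * (1 - fps_X) ^ j"
    using fps_deriv_one_minus_powr[of "real (Suc j)"]
    unfolding one_minus_powr_of_nat by (simp add: one_minus_powr_of_nat[symmetric])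
  also have "fps_const (- real (Suc j)) * (1 - fps_X) ^ j * log_series
      + (1 - fps_X) ^ j * ((1 - fps_X) * fps_deriv log_series)
      = fps_const (- real (Suc j)) * log_power j + fps_const (- real (Suc j) * (1 / real (Suc j))) * (1 - fps_X) ^ j"
    unfolding log_series_ode log_power_def by (simp add: mult.assoc del: of_nat_Suc)
  finally show ?thesis
    unfolding one_minus_powr_of_nat distrib_left mult.assoc[symmetric] fps_const_mult .
qed

lemma log_power_ode:
  "(1 - fps_X) * fps_deriv (log_power j) = - fps_const (real j) * log_power j - one_minus_powr (real j)"
proof (cases j)
  case 0
  then show ?thesis by (simp add: log_power_0 log_series_ode one_minus_powr_0)
next
  case (Suc i)
  have "(1 - fps_X) * fps_deriv (log_power j)
     = fps_const (- real j) * ((1 - fps_X) * log_power i + fps_const (1 / real j) * ((1 - fps_X) * one_minus_powr (real i)))"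
    unfolding Suc fps_deriv_log_power_Suc by (simp add: algebra_simps del: of_nat_Suc)
  also have "(1 - fps_X) * log_power i = log_power j" by (simp only: Suc log_power_Suc)
  also have "(1 - fps_X) * one_minus_powr (real i) = one_minus_powr (real j)"
    by (simp only: Suc one_minus_powr_of_nat power_Suc)
  also have "fps_const (- real j) * (log_power j + fps_const (1 / real j) * one_minus_powr (real j))
     = - fps_const (real j) * log_power j + fps_const (- real j * (1 / real j)) * one_minus_powr (real j)"
    unfolding distrib_left mult.assoc[symmetric] fps_const_mult by simp
  also have "fps_const (- real j * (1 / real j)) = - (1 :: real fps)"
  proof -
    have "real j \<noteq> 0" using Suc by simp
    then show ?thesis by (simp flip: fps_const_neg)
  qed
  finally show ?thesis by simp
qed

text \<open>
  This recurrence determines the signs of the coefficients. For a power of \<open>1 - t\<close> the term \<open>E\<close> is zero, so signs alternate while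
  \<open>n < s\<close> and are constant once \<open>n > s\<close>. For the logarithmic series, the coefficient of \<open>E\<close> at \<open>n = s\<close> fixes the sign of
  the next coefficient, and \<open>E\<close> vanishes afterwards.
\<close>
lemma ode_coeff_recurrence:
  assumes "(1 - fps_X) * fps_deriv F = - fps_const s * F - E"
  shows "real (Suc n) * F $ Suc n = (real n - s) * F $ n - E $ n"
proof -
  have "((1 - fps_X) * fps_deriv F) $ n = (- fps_const s * F - E) $ n" using assms by simp
  then show ?thesis by (cases n) (simp_all add: one_minus_X_mult_nth algebra_simps flip: fps_const_neg)
qed

lemma one_minus_powr_rec: "real (Suc n) * one_minus_powr s $ Suc n = (real n - s) * one_minus_powr s $ n"
  using ode_coeff_recurrence[of "one_minus_powr s" s 0 n] one_minus_powr_ode[of s] by simp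

lemma log_power_rec:
  "real (Suc n) * log_power j $ Suc n = (real n - real j) * log_power j $ n - one_minus_powr (real j) $ n"
  by (rule ode_coeff_recurrence[OF log_power_ode])

lemma sign_transfer: "0 < c \<Longrightarrow> 0 < s * x \<Longrightarrow> c * y = k * x \<Longrightarrow> 0 < k \<Longrightarrow> 0 < s * y" for c s x y k :: real
proof -
  assume a: "0 < c" "0 < s * x" "c * y = k * x" "0 < k"
  have "c * (s * y) = k * (s * x)" using a(3) by (simp add: mult.left_commute)
  moreover have "0 < k * (s * x)" using a by simp
  ultimately show "0 < s * y" using a(1) by (metis zero_less_mult_pos)
qed

lemma one_minus_powr_sign_low:
  assumes "real n < s + 1"
  shows "0 < (-1) ^ n * one_minus_powr s $ n"
  using assms
proof (induction n)
  case (Suc n)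
  have "real (Suc n) * (- one_minus_powr s $ Suc n) = (s - real n) * one_minus_powr s $ n"
    using one_minus_powr_rec[of n s] by (simp add: algebra_simps)
  from sign_transfer[OF _ _ this, of "(-1) ^ n"] show ?case using Suc by simp
qed simp

lemma one_minus_powr_sign:
  assumes s: "s = real m + 1 / 2" and "n \<ge> Suc m"
  shows "0 < (-1) ^ Suc m * one_minus_powr s $ n"
  using assms(2)
proof (induction n rule: dec_induct)
  case base
  show ?case by (rule one_minus_powr_sign_low) (simp add: s)
next
  case (step n)
  have "0 < real n - s" using step s by simp
  then show ?case
    using sign_transfer[OF _ step.IH one_minus_powr_rec] by simp
qed

lemma one_minus_powr_of_nat_eq_0:
  assumes "n \<ge> Suc j"
  shows "one_minus_powr (real j) $ n = 0"
  using assms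
proof (induction n rule: dec_induct)
  case base
  show ?case using one_minus_powr_rec[of j "real j"] by (simp del: of_nat_Suc)
next
  case (step n)
  then show ?case using one_minus_powr_rec[of n "real j"] by (simp del: of_nat_Suc)
qed

lemma log_power_sign:
  assumes "n \<ge> Suc m"
  shows "0 < (-1) ^ Suc m * log_power m $ n"
  using assms
proof (induction n rule: dec_induct)
  case base
  have "real (Suc m) * log_power m $ Suc m = - one_minus_powr (real m) $ m"
    using log_power_rec[of m m] by simp
  then have "real (Suc m) * ((-1) ^ Suc m * log_power m $ Suc m) = (-1) ^ m * one_minus_powr (real m) $ m"
    by (simp add: mult.left_commute[of "real (Suc m)"] del: of_nat_Suc)
  moreover have "0 < (-1) ^ m * one_minus_powr (real m) $ m" by (rule one_minus_powr_sign_low) simp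
  ultimately show ?case by (metis of_nat_0_less_iff zero_less_Suc zero_less_mult_pos)
next
  case (step n)
  have "real (Suc n) * log_power m $ Suc n = (real n - real m) * log_power m $ n"
    using log_power_rec[of n m] step one_minus_powr_of_nat_eq_0[of m n] by simp
  from sign_transfer[OF _ step.IH this] show ?case using step by simp
qed

lemma one_minus_powr_series:
  assumes "s > 0"
  shows "summable (\<lambda>n. \<bar>one_minus_powr s $ n\<bar>)"
    and "\<And>t. \<bar>t\<bar> \<le> 1 \<Longrightarrow> (\<lambda>n. one_minus_powr s $ n * t ^ n) sums ((1 - t) powr s)"
proof -
  define M where "M = nat \<lceil>s\<rceil>"
  define \<sigma> :: real where "\<sigma> = (if one_minus_powr s $ M \<ge> 0 then 1 else -1)"
  have cont: "continuous_on {-1..1} (\<lambda>t. (1 - t) powr s)"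
    using assms by (intro continuous_on_powr' continuous_intros) auto
  have inner: "(\<lambda>n. one_minus_powr s $ n * t ^ n) sums ((1 - t) powr s)" if "\<bar>t\<bar> < 1" for t
    using gen_binomial_real[of "- t" s] that
    by (simp add: one_minus_powr_def power_minus[of t] mult_ac)
  have sgn: "0 \<le> \<sigma> * one_minus_powr s $ n" if "n \<ge> M" for n
    using that
  proof (induction n rule: dec_induct)
    case base
    show ?case by (simp add: \<sigma>_def)
  next
    case (step n)
    have "real n - s \<ge> 0" using step(1) unfolding M_def by linarith
    then have "0 \<le> (real n - s) * (\<sigma> * one_minus_powr s $ n)" using step.IH by simp
    also have "\<dots> = real (Suc n) * (\<sigma> * one_minus_powr s $ Suc n)"
      unfolding mult.left_commute[of _ \<sigma>] one_minus_powr_rec ..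
    finally show ?case by (simp add: zero_le_mult_iff del: of_nat_Suc)
  qed
  have "\<sigma> \<noteq> 0" by (simp add: \<sigma>_def)
  note * = power_series_endpoints[OF cont inner sgn this]
  show "summable (\<lambda>n. \<bar>one_minus_powr s $ n\<bar>)" by (rule *)
  show "\<And>t. \<bar>t\<bar> \<le> 1 \<Longrightarrow> (\<lambda>n. one_minus_powr s $ n * t ^ n) sums ((1 - t) powr s)" by (rule *)
qed

lemma one_minus_powr_partial_sums: "(\<Sum>n\<le>N. one_minus_powr (s + 1) $ n) = one_minus_powr s $ N"
  by (induction N) (simp_all add: one_minus_powr_Suc one_minus_X_mult_nth)

text \<open>
  The coefficients for \<open>s\<close> are the partial sums of those for \<open>s + 1\<close>, whose series at 1 has the sum \<open>0 powr (s + 1)\<close>.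
\<close>
lemma one_minus_powr_tendsto_0:
  assumes "s > -1"
  shows "(\<lambda>n. one_minus_powr s $ n) \<longlonglongrightarrow> 0"
proof -
  have "(\<lambda>n. one_minus_powr (s + 1) $ n) sums 0"
    using one_minus_powr_series(2)[of "s + 1" 1] assms by simp
  then show ?thesis unfolding sums_def_le one_minus_powr_partial_sums .
qed

lemma n_one_minus_powr_tendsto_0:
  assumes "s > 0"
  shows "(\<lambda>n. real n * one_minus_powr s $ n) \<longlonglongrightarrow> 0"
proof -
  have "(\<lambda>n. - s * one_minus_powr (s - 1) $ n) \<longlonglongrightarrow> 0"
    using assms by (intro tendsto_mult_right_zero one_minus_powr_tendsto_0) simp
  moreover have "real (Suc n) * one_minus_powr s $ Suc n = - s * one_minus_powr (s - 1) $ n" for n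
    using arg_cong[OF fps_deriv_one_minus_powr[of s], of "\<lambda>F. F $ n"] by (simp add: algebra_simps)
  ultimately have "(\<lambda>n. real (Suc n) * one_minus_powr s $ Suc n) \<longlonglongrightarrow> 0" by simp
  then show ?thesis by (rule LIMSEQ_imp_Suc)
qed

lemma sums_one_minus_X_mult:
  fixes F :: "real fps"
  assumes "(\<lambda>n. F $ n * t ^ n) sums x"
  shows "(\<lambda>n. ((1 - fps_X) * F) $ n * t ^ n) sums ((1 - t) * x)"
proof -
  have "(\<lambda>n. t * (F $ n * t ^ n)) sums (t * x)" using assms by (rule sums_mult)
  then have "(\<lambda>n. (if Suc n = 0 then 0 else F $ (Suc n - 1)) * t ^ Suc n) sums (t * x)"
    by (simp add: mult_ac)
  then have "(\<lambda>n. (if n = 0 then 0 else F $ (n - 1)) * t ^ n) sums (t * x)"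
    by (subst (asm) sums_Suc_iff) simp
  from sums_diff[OF assms this] show ?thesis
    by (simp add: one_minus_X_mult_nth left_diff_distrib)
qed

lemma continuous_on_power_mult_log:
  assumes "j \<ge> 1"
  shows "continuous_on {-1..1} (\<lambda>t::real. (1 - t) ^ j * ln (2 - 2 * t))"
proof -
  have "continuous_on {-1..1} (\<lambda>t. polyharmonic_spline 2 (Suc j) (sqrt (2 - 2 * t)))"
    by (rule continuous_on_compose2[OF continuous_on_polyharmonic_spline[of 2 "Suc j"]])
       (use assms in \<open>auto intro!: continuous_intros\<close>)
  then have "continuous_on {-1..1} (\<lambda>t. (2 / 2 ^ j) * polyharmonic_spline 2 (Suc j) (sqrt (2 - 2 * t)))"
    by (intro continuous_intros)
  moreover have "(2 / 2 ^ j) * polyharmonic_spline 2 (Suc j) (sqrt (2 - 2 * t)) = (1 - t) ^ j * ln (2 - 2 * t)"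
    if "t \<in> {-1..1}" for t :: real
  proof (cases "t = 1")
    case False
    then have t: "2 - 2 * t > 0" using that by auto
    have "sqrt (2 - 2 * t) ^ (2 * j) = 2 ^ j * (1 - t) ^ j"
      using t by (simp add: power_mult power_mult_distrib[symmetric])
    then show ?thesis
      using t by (simp add: polyharmonic_spline_def ln_sqrt)
  qed (use assms in \<open>simp add: polyharmonic_spline_def\<close>)
  ultimately show ?thesis by (rule continuous_on_eq)
qed

lemma log_power_series:
  assumes "j \<ge> 1"
  shows "summable (\<lambda>n. \<bar>log_power j $ n\<bar>)"
    and "\<And>t. \<bar>t\<bar> \<le> 1 \<Longrightarrow> (\<lambda>n. log_power j $ n * t ^ n) sums ((1 - t) ^ j * ln (2 - 2 * t))"
proof -
  have inner: "(\<lambda>n. log_power i $ n * t ^ n) sums ((1 - t) ^ i * ln (2 - 2 * t))" if t: "\<bar>t\<bar> < 1" for t :: real and i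
  proof (induction i)
    case 0
    have "(\<lambda>n. (if n = 0 then ln 2 else 0) + - (t ^ n) / real n) sums (ln 2 + ln (1 - t))"
      using sums_add[OF sums_single[of 0 "\<lambda>_. ln 2"] Complex_Transcendental.ln_series'[of "- t"]] t by simp
    moreover have "ln 2 + ln (1 - t) = ln (2 - 2 * t)"
      using t ln_mult[of 2 "1 - t"] by (simp add: algebra_simps)
    moreover have "(if n = 0 then ln 2 else 0) + - (t ^ n) / real n = log_power 0 $ n * t ^ n" for n
      by (simp add: log_power_0 log_series_def)
    ultimately show ?case by simp
  next
    case (Suc i)
    then show ?case unfolding log_power_Suc using sums_one_minus_X_mult[OF Suc] by (simp add: mult.assoc)
  qed
  have sgn: "0 \<le> (-1) ^ Suc j * log_power j $ n" if "n \<ge> Suc j" for n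
    using log_power_sign[OF that] by simp
  have ne: "(-1 :: real) ^ Suc j \<noteq> 0" by simp
  note * = power_series_endpoints[OF continuous_on_power_mult_log[OF assms] inner sgn ne]
  show "summable (\<lambda>n. \<bar>log_power j $ n\<bar>)" by (rule *)
  show "\<And>t. \<bar>t\<bar> \<le> 1 \<Longrightarrow> (\<lambda>n. log_power j $ n * t ^ n) sums ((1 - t) ^ j * ln (2 - 2 * t))" by (rule *)
qed

lemma log_power_tendsto_0: "(\<lambda>n. log_power j $ n) \<longlonglongrightarrow> 0"
proof (cases j)
  case 0
  have "(\<lambda>n. - (1 / real (Suc n))) \<longlonglongrightarrow> - 0" by (intro tendsto_minus lim_1_over_n LIMSEQ_Suc)
  then have "(\<lambda>n. log_power j $ Suc n) \<longlonglongrightarrow> 0" by (simp add: 0 log_power_0 log_series_def)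
  then show ?thesis by (rule LIMSEQ_imp_Suc)
next
  case (Suc i)
  then show ?thesis
    using summable_LIMSEQ_zero[OF log_power_series(1)[of j]] tendsto_rabs_zero_iff by auto
qed

lemma n_log_power_tendsto_0:
  assumes "j \<ge> 1"
  shows "(\<lambda>n. real n * log_power j $ n) \<longlonglongrightarrow> 0"
proof -
  obtain i where j: "j = Suc i" using assms by (cases j) auto
  have "(\<lambda>n. - real j * (log_power i $ n + 1 / real j * one_minus_powr (real i) $ n)) \<longlonglongrightarrow> 0"
    by (intro tendsto_mult_right_zero tendsto_add_zero log_power_tendsto_0 one_minus_powr_tendsto_0) simp
  moreover have "real (Suc n) * log_power j $ Suc n
      = - real j * (log_power i $ n + 1 / real j * one_minus_powr (real i) $ n)" for n
    using arg_cong[OF fps_deriv_log_power_Suc[of i], of "\<lambda>F. F $ n"]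
    by (simp add: j algebra_simps flip: fps_const_neg)
  ultimately have "(\<lambda>n. real (Suc n) * log_power j $ Suc n) \<longlonglongrightarrow> 0" by simp
  then show ?thesis by (rule LIMSEQ_imp_Suc)
qed

section \<open>Nonvanishing of the low Gegenbauer coefficients\<close>

lemma sphere_mean_one_minus_powr_step:
  assumes D: "D \<ge> 1" and s: "s > 0" and c: "sphere_mean_sums D (one_minus_powr s) c"
  shows "sphere_mean_sums D (one_minus_powr (s + 1)) ((2 * s + real D - 1) / (s + real D - 1) * c)"
proof -
  have "summable (\<lambda>n. \<bar>one_minus_powr (s + 1) $ n\<bar>)"
    using s by (intro one_minus_powr_series) simp
  then obtain c' where c': "sphere_mean_sums D (one_minus_powr (s + 1)) c'"
    using ex_sphere_mean_sums[OF D] by blast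
  have zero: "sphere_mean_sums D 0 0" by (simp add: sphere_mean_sums_def)
  have "(s + real D - 1) * c' = (2 * s + real D - 1) * c + 2 * 0 - 0"
    by (rule sphere_mean_recurrence[OF D n_one_minus_powr_tendsto_0[OF s] _ c _ zero])
       (use c' zero in \<open>simp_all add: one_minus_powr_ode one_minus_powr_Suc\<close>)
  moreover have "s + real D - 1 > 0" using D s by simp
  ultimately have "c' = (2 * s + real D - 1) / (s + real D - 1) * c" by (simp add: field_simps)
  then show ?thesis using c' by simp
qed

text \<open>
  For exponent \<open>1 / 2\<close> all coefficients but the first are negative. As all moments are at most 1, the mean is bounded
  below by the sum of the even coefficients, which is half the sum of the values at \<open>1\<close> and \<open>-1\<close>.
\<close>
lemma sphere_mean_half_integer_pos:
  assumes D: "D \<ge> 1"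
  shows "\<exists>c>0. sphere_mean_sums D (one_minus_powr (real i + 1 / 2)) c"
proof (induction i)
  case 0
  let ?P = "one_minus_powr (1 / 2)"
  have neg: "?P $ n < 0" if "n \<ge> 1" for n
    using one_minus_powr_sign[of "1 / 2" 0 n] that by simp
  have "(\<lambda>n. ?P $ n * 1 ^ n + ?P $ n * (-1) ^ n) sums ((1 - 1) powr (1 / 2) + (1 - (-1)) powr (1 / 2))"
    by (intro sums_add one_minus_powr_series) auto
  then have "(\<lambda>n. ?P $ n * (1 + (-1) ^ n)) sums (2 powr (1 / 2))" by (simp add: ring_distribs)
  then have "(\<lambda>j. ?P $ (2 * j) * (1 + (-1) ^ (2 * j))) sums (2 powr (1 / 2))"
  proof (subst sums_mono_reindex[of "\<lambda>j. 2 * j"])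
    fix n :: nat assume "n \<notin> range (\<lambda>j. 2 * j)"
    then have "odd n" by (auto elim!: evenE)
    then show "?P $ n * (1 + (-1) ^ n) = 0" by simp
  qed (auto simp: strict_mono_def)
  then have even: "(\<lambda>j. 2 * ?P $ (2 * j)) sums (2 powr (1 / 2))" by (simp add: mult.commute)
  obtain c where c: "sphere_mean_sums D ?P c"
    using ex_sphere_mean_sums[OF D one_minus_powr_series(1)] by fastforce
  then have upper: "(\<lambda>j. 2 * (sphere_moment D j * ?P $ (2 * j))) sums (2 * c)"
    unfolding sphere_mean_sums_def by (rule sums_mult)
  have le: "2 * ?P $ (2 * j) \<le> 2 * (sphere_moment D j * ?P $ (2 * j))" for j
  proof (cases "j = 0")
    case False
    then have "1 * ?P $ (2 * j) \<le> sphere_moment D j * ?P $ (2 * j)"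
      using neg[of "2 * j"] sphere_moment_le_1[OF D, of j] by (intro mult_right_mono_neg) auto
    then show ?thesis by simp
  qed simp
  have "2 powr (1 / 2) \<le> 2 * c" by (rule sums_le[OF le even upper])
  moreover have "2 powr (1 / 2) > (0 :: real)" by simp
  ultimately have "c > 0" by linarith
  then show ?case using c by auto
next
  case (Suc i)
  then obtain c where c: "c > 0" "sphere_mean_sums D (one_minus_powr (real i + 1 / 2)) c" by blast
  have "0 < (2 * (real i + 1 / 2) + real D - 1) / (real i + 1 / 2 + real D - 1)"
    using D by (intro divide_pos_pos) auto
  then have "0 < (2 * (real i + 1 / 2) + real D - 1) / (real i + 1 / 2 + real D - 1) * c"
    by (rule mult_pos_pos[OF _ c(1)])
  moreover have "real (Suc i) + 1 / 2 = (real i + 1 / 2) + 1" by simp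
  ultimately show ?case
    using sphere_mean_one_minus_powr_step[OF D _ c(2)] by (intro exI conjI) simp_all
qed

lemma sphere_mean_integer_pos:
  assumes D: "D \<ge> 2"
  shows "\<exists>c>0. sphere_mean_sums D (one_minus_powr (real j)) c"
proof (cases j)
  case 0
  have "(\<lambda>j. sphere_moment D j * (1 :: real fps) $ (2 * j)) sums 1"
    using sums_single[of 0 "\<lambda>j. sphere_moment D j"] by (simp add: if_distrib cong: if_cong)
  then show ?thesis using 0 by (intro exI[of _ 1]) (simp add: sphere_mean_sums_def one_minus_powr_0)
next
  case (Suc i)
  have "\<exists>c>0. sphere_mean_sums D (one_minus_powr (real i + 1)) c"
  proof (induction i)
    case 0
    have "one_minus_powr 1 = (1 - fps_X :: real fps)" using one_minus_powr_of_nat[of 1] by simp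
    then have "sphere_moment D j * one_minus_powr 1 $ (2 * j) = (if j = 0 then 1 else 0)" for j by simp
    then have "(\<lambda>j. sphere_moment D j * one_minus_powr 1 $ (2 * j)) sums 1"
      using sums_single[of 0 "\<lambda>_. 1 :: real"] by simp
    then show ?case by (intro exI[of _ 1]) (simp add: sphere_mean_sums_def)
  next
    case (Suc i)
    then obtain c where c: "c > 0" "sphere_mean_sums D (one_minus_powr (real i + 1)) c" by blast
    have "0 < (2 * (real i + 1) + real D - 1) / (real i + 1 + real D - 1) * c"
      using D c(1) by (intro mult_pos_pos divide_pos_pos) auto
    moreover have "real (Suc i) + 1 = (real i + 1) + 1" by simp
    ultimately show ?case
      using sphere_mean_one_minus_powr_step[OF _ _ c(2)] D by (intro exI conjI) simp_all
  qed
  then show ?thesis using Suc by (simp add: add.commute)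
qed

text \<open>
  For exponent 1 all even coefficients are positive. The recurrence keeps the mean positive, since it adds
  \<open>2 * c - q * c\<close>, where \<open>c\<close> and \<open>q * c\<close> are the means of consecutive powers of \<open>1 - t\<close>, and \<open>q \<le> 2\<close>.
\<close>
lemma sphere_mean_log_power_pos:
  assumes D: "D \<ge> 2"
  shows "\<exists>b>0. sphere_mean_sums D (log_power (Suc j)) b"
proof (induction j)
  case 0
  have pos: "log_power (Suc 0) $ (2 * j) > 0" for j
  proof (cases "j = 0")
    case True
    then show ?thesis by (simp add: log_power_Suc log_power_0 log_series_def one_minus_X_mult_nth)
  next
    case False
    then show ?thesis using log_power_sign[of "Suc 0" "2 * j"] by simp
  qed
  obtain b where b: "sphere_mean_sums D (log_power (Suc 0)) b"
    using ex_sphere_mean_sums[OF _ log_power_series(1)] D by fastforce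
  then have "b = (\<Sum>j. sphere_moment D j * log_power (Suc 0) $ (2 * j))"
    and "summable (\<lambda>j. sphere_moment D j * log_power (Suc 0) $ (2 * j))"
    by (auto simp: sphere_mean_sums_def sums_iff)
  then have "b > 0" using pos sphere_moment_pos[of D] D by (simp add: suminf_pos)
  then show ?case using b by blast
next
  case (Suc j)
  then obtain b where b: "b > 0" "sphere_mean_sums D (log_power (Suc j)) b" by blast
  have D1: "D \<ge> 1" using D by simp
  obtain b' where b': "sphere_mean_sums D (log_power (Suc (Suc j))) b'"
    using ex_sphere_mean_sums[OF D1 log_power_series(1)] by fastforce
  obtain c where c: "c > 0" "sphere_mean_sums D (one_minus_powr (real (Suc j))) c"
    using sphere_mean_integer_pos[OF D] by blast
  define s where "s = real (Suc j)"
  have s: "s > 0" by (simp add: s_def)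
  define q where "q = (2 * s + real D - 1) / (s + real D - 1)"
  have cs: "sphere_mean_sums D ((1 - fps_X) * one_minus_powr (real (Suc j))) (q * c)"
    using sphere_mean_one_minus_powr_step[OF D1 s, of c] c(2)
    by (simp only: one_minus_powr_Suc q_def s_def)
  have "(s + real D - 1) * b' = (2 * s + real D - 1) * b + 2 * c - q * c"
    unfolding s_def
    by (rule sphere_mean_recurrence[OF D1 n_log_power_tendsto_0 log_power_ode b(2) _ c(2) cs])
       (use b' in \<open>simp_all add: log_power_Suc\<close>)
  moreover have "q \<le> 2" using D s by (simp add: q_def divide_le_eq)
  then have "q * c \<le> 2 * c" using c(1) by simp
  moreover have "(2 * s + real D - 1) * b > 0" using D s b(1) by simp
  ultimately have "(s + real D - 1) * b' > 0" by linarith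
  moreover have "s + real D - 1 > 0" using D s by simp
  ultimately have "b' > 0" by (simp add: zero_less_mult_iff)
  then show ?case using b' by blast
qed

text \<open>
  The moments decrease fast enough that \<open>sphere_moment D j / (2 * real j)\<close> is dominated by twice the decrement of the moments, whose
  telescoping sum is at most 1. The bound \<open>-1\<close> is what \<open>gegenbauer_coeff_sums_log\<close> needs: for \<open>l = m > 0\<close> a constant \<open>r \<ge> 1\<close> is
  added to the logarithm.
\<close>
lemma sphere_mean_log_gt:
  assumes D: "D \<ge> 2"
  shows "\<exists>b>-1. sphere_mean_sums D log_series b"
proof -
  define t where "t j = sphere_moment D j / (2 * real j)" for j
  have D1: "D \<ge> 1" using D by simp
  have t0: "t j \<ge> 0" for j using sphere_moment_pos[OF D1, of j] by (simp add: t_def)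
  have tele: "t (Suc j) \<le> 2 * (sphere_moment D (Suc j) - sphere_moment D (Suc (Suc j)))" for j
  proof -
    define i where "i = real (Suc j)"
    have i: "i \<ge> 1" by (simp add: i_def)
    have "1 / (2 * i) \<le> 2 * (1 - (2 * i + 1) / (real D + 2 * i))"
    proof -
      have "(real D - 2) * (4 * i - 1) \<ge> 0" using D i by simp
      then have "real D + 2 * i \<le> 4 * i * (real D - 1)"
        using i by (simp add: algebra_simps)
      then show ?thesis using D i by (simp add: field_simps)
    qed
    then have "sphere_moment D (Suc j) * (1 / (2 * i))
        \<le> sphere_moment D (Suc j) * (2 * (1 - (2 * i + 1) / (real D + 2 * i)))"
      using sphere_moment_pos[OF D1, of "Suc j"] by (intro mult_left_mono) auto
    then show ?thesis
      unfolding t_def sphere_moment_Suc[of D "Suc j"] i_def[symmetric] by (simp add: algebra_simps)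
  qed
  have partial: "(\<Sum>j<Suc J. t j) \<le> 1 - 2 * sphere_moment D (Suc J)" for J
  proof (induction J)
    case 0
    show ?case using D by (simp add: t_def sphere_moment_Suc field_simps)
  next
    case (Suc J)
    then show ?case using tele[of J] by (simp add: algebra_simps)
  qed
  have bound: "(\<Sum>j<J. t j) \<le> 1" for J
  proof (cases J)
    case (Suc i)
    show ?thesis unfolding Suc using partial[of i] sphere_moment_pos[OF D1, of "Suc i"] by linarith
  qed simp
  have summ: "summable t" by (rule summableI_nonneg_bounded[OF t0 bound])
  then have "suminf t \<le> 1" using bound by (intro suminf_le_const)
  have "(\<lambda>j. (if j = 0 then ln 2 else 0) - t j) sums (ln 2 - suminf t)"
    using sums_single[of 0 "\<lambda>_. ln 2 :: real"] summ by (intro sums_diff summable_sums) auto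
  moreover have "(if j = 0 then ln 2 else 0) - t j = sphere_moment D j * log_series $ (2 * j)" for j
    by (simp add: t_def log_series_def)
  ultimately have "sphere_mean_sums D log_series (ln 2 - suminf t)"
    by (simp add: sphere_mean_sums_def)
  moreover have "ln 2 - suminf t > -1"
    using \<open>suminf t \<le> 1\<close> ln_gt_zero[of "2 :: real"] by linarith
  ultimately show ?thesis by blast
qed

lemma iterated_deriv_one_minus_powr:
  assumes "real l < s + 1"
  shows "\<exists>c. c \<noteq> 0 \<and> (fps_deriv ^^ l) (one_minus_powr s) = fps_const c * one_minus_powr (s - real l)"
  using assms
proof (induction l)
  case 0
  show ?case by (intro exI[of _ 1]) simp
next
  case (Suc l)
  then obtain c where c: "c \<noteq> 0" "(fps_deriv ^^ l) (one_minus_powr s) = fps_const c * one_minus_powr (s - real l)"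
    by auto
  have "(fps_deriv ^^ Suc l) (one_minus_powr s) = fps_const (c * - (s - real l)) * one_minus_powr (s - real (Suc l))"
    by (simp add: c(2) fps_deriv_one_minus_powr mult.assoc[symmetric] diff_diff_eq add.commute)
  moreover have "c * - (s - real l) \<noteq> 0" using c(1) Suc.prems by simp
  ultimately show ?case by blast
qed

text \<open>
  Each differentiation of \<open>(1 - t) ^ i * (ln (2 - 2 * t) + r)\<close> adds \<open>1 / i\<close> to \<open>r\<close>, and the last one has \<open>i = 1\<close>.
\<close>
lemma iterated_deriv_log_power:
  assumes "l \<le> m"
  shows "\<exists>c r. c \<noteq> 0 \<and> r \<ge> 0 \<and> (l = m \<and> m > 0 \<longrightarrow> r \<ge> 1) \<and>
    (fps_deriv ^^ l) (log_power m) = fps_const c * (log_power (m - l) + fps_const r * one_minus_powr (real (m - l)))"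
  using assms
proof (induction l)
  case 0
  show ?case by (rule exI[of _ 1], rule exI[of _ 0]) auto
next
  case (Suc l)
  define i where "i = m - Suc l"
  have i: "m - l = Suc i" using Suc.prems by (simp add: i_def)
  obtain c r where c: "c \<noteq> 0" "r \<ge> 0"
    "(fps_deriv ^^ l) (log_power m) = fps_const c * (log_power (Suc i) + fps_const r * one_minus_powr (real (Suc i)))"
    using Suc unfolding i by auto
  define k where "k = real (Suc i)"
  have k: "k > 0" "real (Suc i) = k" "k - 1 = real i" by (simp_all add: k_def)
  have "fps_deriv (log_power (Suc i) + fps_const r * one_minus_powr k)
      = fps_const (- k) * (log_power i + fps_const (1 / k) * one_minus_powr (real i))
        + fps_const r * (fps_const (- k) * one_minus_powr (real i))"
    using fps_deriv_log_power_Suc[of i] by (simp add: k fps_deriv_one_minus_powr del: of_nat_Suc)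
  also have "\<dots> = fps_const (- k) * (log_power i + (fps_const (1 / k) + fps_const r) * one_minus_powr (real i))"
    by (simp only: algebra_simps)
  also have "fps_const (1 / k) + fps_const r = fps_const (1 / k + r)" by simp
  finally have "(fps_deriv ^^ Suc l) (log_power m)
      = fps_const (c * - k) * (log_power i + fps_const (1 / k + r) * one_minus_powr (real i))"
    using c(3) by (simp add: k(2) mult.assoc[symmetric] del: of_nat_Suc)
  moreover have "Suc l = m \<and> m > 0 \<longrightarrow> 1 / k + r \<ge> 1"
    using c(2) by (auto simp: i_def k_def)
  ultimately show ?case
    unfolding i_def[symmetric] using c k by (intro exI[of _ "c * - k"] exI[of _ "1 / k + r"]) simp
qed

lemma gegenbauer_coeff_sums_half_integer:
  assumes d: "d \<ge> 2" and l: "l \<le> m"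
  shows "\<exists>c. c \<noteq> 0 \<and> (\<lambda>n. one_minus_powr (real m + 1 / 2) $ n * gegenbauer_coeff d l n) sums c"
proof -
  obtain c where c: "c \<noteq> 0"
    "(fps_deriv ^^ l) (one_minus_powr (real m + 1 / 2)) = fps_const c * one_minus_powr (real m + 1 / 2 - real l)"
    using iterated_deriv_one_minus_powr[of l "real m + 1 / 2"] l by auto
  have e: "real m + 1 / 2 - real l = real (m - l) + 1 / 2" using l by (simp add: of_nat_diff)
  obtain h where h: "h > 0" "sphere_mean_sums (d + 2 * l) (one_minus_powr (real (m - l) + 1 / 2)) h"
    using sphere_mean_half_integer_pos[of "d + 2 * l" "m - l"] d by auto
  have "sphere_mean_sums (d + 2 * l) ((fps_deriv ^^ l) (one_minus_powr (real m + 1 / 2))) (c * h)"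
    unfolding c(2) e by (rule sphere_mean_sums_cmult[OF h(2)])
  from gegenbauer_coeff_sums[OF d this] show ?thesis
    using c(1) h(1) by (intro exI[of _ "c * h / fact l"]) simp
qed

lemma gegenbauer_coeff_sums_log:
  assumes d: "d \<ge> 2" and l: "l \<le> m" and m: "m > 0"
  shows "\<exists>c. c \<noteq> 0 \<and> (\<lambda>n. log_power m $ n * gegenbauer_coeff d l n) sums c"
proof -
  obtain c r where c: "c \<noteq> 0" "r \<ge> 0" "l = m \<Longrightarrow> r \<ge> 1"
    and deriv: "(fps_deriv ^^ l) (log_power m)
      = fps_const c * (log_power (m - l) + fps_const r * one_minus_powr (real (m - l)))"
    using iterated_deriv_log_power[OF l] m by blast
  have D: "d + 2 * l \<ge> 2" using d by simp
  obtain h where h: "h > 0" "sphere_mean_sums (d + 2 * l) (log_power (m - l) + fps_const r * one_minus_powr (real (m - l))) h"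
  proof (cases "l = m")
    case True
    obtain b where b: "b > -1" "sphere_mean_sums (d + 2 * l) log_series b"
      using sphere_mean_log_gt[OF D] by blast
    have "(\<lambda>j. sphere_moment (d + 2 * l) j * (1 :: real fps) $ (2 * j)) sums 1"
      using sums_single[of 0 "\<lambda>j. sphere_moment (d + 2 * l) j"] by (simp add: if_distrib cong: if_cong)
    then have "sphere_mean_sums (d + 2 * l) 1 1" by (simp add: sphere_mean_sums_def)
    then have "sphere_mean_sums (d + 2 * l) (log_series + fps_const r * 1) (b + r * 1)"
      by (intro sphere_mean_sums_add sphere_mean_sums_cmult b(2))
    moreover have "b + r * 1 > 0" using b(1) c(3)[OF True] by simp
    ultimately show ?thesis using that[of "b + r * 1"] True by (simp add: log_power_0 one_minus_powr_0)
  next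
    case False
    then obtain i where i: "m - l = Suc i" using l by (metis Suc_diff_Suc le_neq_implies_less)
    obtain b where b: "b > 0" "sphere_mean_sums (d + 2 * l) (log_power (Suc i)) b"
      using sphere_mean_log_power_pos[OF D] by blast
    obtain e where e: "e > 0" "sphere_mean_sums (d + 2 * l) (one_minus_powr (real (Suc i))) e"
      using sphere_mean_integer_pos[OF D] by blast
    have "b + r * e > 0" using b(1) c(2) e(1) by (simp add: add_pos_nonneg)
    moreover have "sphere_mean_sums (d + 2 * l) (log_power (Suc i) + fps_const r * one_minus_powr (real (Suc i))) (b + r * e)"
      by (intro sphere_mean_sums_add sphere_mean_sums_cmult b(2) e(2))
    ultimately show ?thesis using that i by simp
  qed
  have "sphere_mean_sums (d + 2 * l) ((fps_deriv ^^ l) (log_power m)) (c * h)"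
    unfolding deriv by (rule sphere_mean_sums_cmult[OF h(2)])
  from gegenbauer_coeff_sums[OF d this] show ?thesis
    using c(1) h(1) by (intro exI[of _ "c * h / fact l"]) simp
qed

section \<open>Density of the polyharmonic spline translates\<close>

lemma polyharmonic_spline_odd:
  assumes "t \<le> 1" "odd d" "2 * k - d = 2 * m + 1"
  shows "polyharmonic_spline d k (sqrt (2 - 2 * t)) = 2 powr (real m + 1 / 2) * (1 - t) powr (real m + 1 / 2)"
proof -
  have "sqrt (2 - 2 * t) ^ (2 * m + 1) = (2 - 2 * t) powr (real m + 1 / 2)"
  proof (cases "t = 1")
    case False
    then have t: "2 - 2 * t > 0" using assms(1) by simp
    then have "sqrt (2 - 2 * t) ^ (2 * m + 1) = (2 - 2 * t) ^ m * (2 - 2 * t) powr (1 / 2)"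
      by (simp add: power_mult powr_half_sqrt)
    then show ?thesis using t by (simp add: powr_add powr_realpow)
  qed simp
  also have "\<dots> = (2 * (1 - t)) powr (real m + 1 / 2)" by (simp add: algebra_simps)
  also have "\<dots> = 2 powr (real m + 1 / 2) * (1 - t) powr (real m + 1 / 2)"
    by (rule powr_mult)
  finally show ?thesis
    unfolding polyharmonic_spline_def assms(3) using assms(2) by (simp only: if_True not_False_eq_True)
qed

lemma polyharmonic_spline_even:
  assumes "t \<le> 1" "even d" "2 * k - d = 2 * m" "m > 0"
  shows "polyharmonic_spline d k (sqrt (2 - 2 * t)) = 2 ^ m / 2 * ((1 - t) ^ m * ln (2 - 2 * t))"
proof (cases "t = 1")
  case False
  then have t: "2 - 2 * t > 0" using assms(1) by simp
  then have "sqrt (2 - 2 * t) ^ (2 * m) = 2 ^ m * (1 - t) ^ m"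
    by (simp add: power_mult power_mult_distrib[symmetric])
  then show ?thesis
    using assms t by (simp add: polyharmonic_spline_def ln_sqrt)
qed (use assms in \<open>simp add: polyharmonic_spline_def\<close>)

lemma norm_diff_unit_sphere:
  "norm (point_of x - point_of y) = sqrt (2 - 2 * (point_of x \<bullet> point_of y))"
  by (simp add: norm_eq_sqrt_inner inner_diff inner_commute)
     (simp add: dot_square_norm)

lemma spline_translates_eq_range_zonal:
  assumes sum: "summable (\<lambda>n. \<bar>a n\<bar>)"
    and series: "\<And>t. \<bar>t\<bar> \<le> 1 \<Longrightarrow> (\<lambda>n. a n * t ^ n) sums polyharmonic_spline CARD('n) k (sqrt (2 - 2 * t))"
  shows "(spline_translates k :: ('n::finite unit_sphere \<Rightarrow>\<^sub>C real) set) = range (zonal a)"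
proof -
  have val: "apply_bcontfun (zonal a y) x = polyharmonic_spline CARD('n) k (norm (point_of x - point_of y))"
    for x y :: "'n unit_sphere"
    using sums_zonal_apply[OF sum, of x y] series[of "point_of x \<bullet> point_of y"] abs_inner_point_of_le[of x "point_of y"]
    unfolding norm_diff_unit_sphere by (simp add: sums_unique2)
  show ?thesis
  proof
    show "(spline_translates k :: ('n unit_sphere \<Rightarrow>\<^sub>C real) set) \<subseteq> range (zonal a)"
    proof
      fix f :: "'n unit_sphere \<Rightarrow>\<^sub>C real" assume "f \<in> spline_translates k"
      then obtain y where "\<And>x. apply_bcontfun f x = polyharmonic_spline CARD('n) k (norm (point_of x - point_of y))"
        unfolding spline_translates_def by blast
      then have "f = zonal a y" by (intro bcontfun_eqI) (simp add: val)
      then show "f \<in> range (zonal a)" by simp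
    qed
    show "range (zonal a) \<subseteq> (spline_translates k :: ('n unit_sphere \<Rightarrow>\<^sub>C real) set)"
      unfolding spline_translates_def by (auto simp: val)
  qed
qed

text \<open>
  In dimension one the sphere has two points. The spline vanishes at distance 0 but not at distance 2, so the two
  translates are multiples of the indicator functions of the points.
\<close>
lemma fundamental_two_point_sphere:
  assumes k: "k > 0" and card: "CARD('n::finite) = 1"
  shows "fundamental (spline_translates k :: ('n unit_sphere \<Rightarrow>\<^sub>C real) set)"
proof -
  obtain i :: 'n where i: "UNIV = {i}" using card by (metis card_1_singletonE)
  obtain y :: "'n unit_sphere" where True by blast
  define y' where "y' = unit_sphere_of (- point_of y)"
  have y': "point_of y' = - point_of y" unfolding y'_def by (rule unit_sphere_of_inverse) simp
  have cases: "x = y \<or> x = y'" for x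
  proof -
    have "norm p = \<bar>vec_nth p i\<bar>" for p :: "real^'n" by (simp add: norm_vec_def L2_set_def i)
    then have "\<bar>vec_nth (point_of x) i\<bar> = 1" "\<bar>vec_nth (point_of y) i\<bar> = 1"
      using norm_point_of by metis+
    then have "vec_nth (point_of x) i = vec_nth (point_of y) i \<or> vec_nth (point_of x) i = - vec_nth (point_of y) i"
      by linarith
    moreover have "j = i" for j using i by blast
    ultimately have "point_of x = point_of y \<or> point_of x = point_of y'"
      unfolding y' vec_eq_iff by (metis vector_uminus_component)
    then show ?thesis by (simp add: point_of_inject)
  qed
  define c where "c = polyharmonic_spline CARD('n) k 2"
  have c: "c \<noteq> 0" by (simp add: c_def polyharmonic_spline_def card)
  have zero: "polyharmonic_spline CARD('n) k 0 = 0" using k by (simp add: polyharmonic_spline_def card)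
  have "norm (point_of y - point_of y') = 2"
  proof -
    have "point_of y - point_of y' = 2 *\<^sub>R point_of y" unfolding y' by (simp add: scaleR_2)
    then show ?thesis by simp
  qed
  then have dist: "norm (point_of y - point_of y') = 2" "norm (point_of y' - point_of y) = 2"
    by (simp_all add: norm_minus_commute)
  have kc: "real k > real CARD('n) / 2" using k card by simp
  obtain f where f: "f \<in> spline_translates k"
    "\<And>x. apply_bcontfun f x = polyharmonic_spline CARD('n) k (norm (point_of x - point_of y))"
    using ex_spline_translate[OF kc, of y] by blast
  obtain f' where f': "f' \<in> spline_translates k"
    "\<And>x. apply_bcontfun f' x = polyharmonic_spline CARD('n) k (norm (point_of x - point_of y'))"
    using ex_spline_translate[OF kc, of y'] by blast
  have "g \<in> span (spline_translates k)" for g :: "'n unit_sphere \<Rightarrow>\<^sub>C real"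
  proof -
    have "g = (apply_bcontfun g y' / c) *\<^sub>R f + (apply_bcontfun g y / c) *\<^sub>R f'"
    proof (rule bcontfun_eqI)
      fix x
      show "apply_bcontfun g x = apply_bcontfun ((apply_bcontfun g y' / c) *\<^sub>R f + (apply_bcontfun g y / c) *\<^sub>R f') x"
        using cases[of x] c by (auto simp: f(2) f'(2) dist zero simp flip: c_def)
    qed
    then show ?thesis
      by (metis f(1) f'(1) span_add span_base span_scale)
  qed
  then have "span (spline_translates k) = (UNIV :: ('n unit_sphere \<Rightarrow>\<^sub>C real) set)" by auto
  then show ?thesis by (simp add: fundamental_iff_span_dense)
qed

theorem theorem10:
  fixes k :: nat
  assumes "real k > real CARD('n::finite) / 2"
  shows "fundamental (spline_translates k :: ('n unit_sphere \<Rightarrow>\<^sub>C real) set)"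
proof (cases "CARD('n) = 1")
  case True
  then show ?thesis using assms by (intro fundamental_two_point_sphere) auto
next
  case False
  then have d: "CARD('n) \<ge> 2" using zero_less_card_finite[where 'a = 'n] by linarith
  have kd: "2 * k > CARD('n)" using assms by linarith
  have dense: ?thesis
    if sum: "summable (\<lambda>n. \<bar>a n\<bar>)"
      and series: "\<And>t. \<bar>t\<bar> \<le> 1 \<Longrightarrow> (\<lambda>n. a n * t ^ n) sums polyharmonic_spline CARD('n) k (sqrt (2 - 2 * t))"
      and sgn: "\<And>n. n \<ge> M \<Longrightarrow> 0 < \<sigma> * a n"
      and low: "\<And>l. l < M \<Longrightarrow> \<exists>c. c \<noteq> 0 \<and> (\<lambda>n. a n * gegenbauer_coeff CARD('n) l n) sums c"
    for a :: "nat \<Rightarrow> real" and M \<sigma>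
  proof -
    have "(spline_translates k :: ('n unit_sphere \<Rightarrow>\<^sub>C real) set) = range (zonal a)"
      by (rule spline_translates_eq_range_zonal[OF sum series])
    then show ?thesis
      unfolding fundamental_iff_span_dense
      using zonal_span_dense_criterion[OF d sum sgn low] by simp
  qed
  have scale: "\<exists>c. c \<noteq> 0 \<and> (\<lambda>n. C * a n * g n) sums c"
    if C: "C \<noteq> 0" and ex: "\<exists>c. c \<noteq> 0 \<and> (\<lambda>n. a n * g n) sums c" for C :: real and a g :: "nat \<Rightarrow> real"
  proof -
    obtain c where "c \<noteq> 0" "(\<lambda>n. a n * g n) sums c" using ex by (elim exE conjE)
    then show ?thesis using C sums_mult[of "\<lambda>n. a n * g n" c C]
      by (intro exI[of _ "C * c"]) (simp add: mult.assoc)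
  qed
  show ?thesis
  proof (cases "odd CARD('n)")
    case True
    then have "odd (2 * k - CARD('n))" using kd by simp
    then obtain m where m: "2 * k - CARD('n) = 2 * m + 1" by (rule oddE)
    define s where "s = real m + 1 / 2"
    have s: "s > 0" by (simp add: s_def)
    \<comment> \<open>from degree \<open>m + 1\<close> on, that is above the exponent, all coefficients have the sign \<open>(-1) ^ Suc m\<close>\<close>
    show ?thesis
    proof (rule dense[where M = "Suc m" and \<sigma> = "(-1) ^ Suc m" and a = "\<lambda>n. 2 powr s * one_minus_powr s $ n"])
      show "summable (\<lambda>n. \<bar>2 powr s * one_minus_powr s $ n\<bar>)"
        unfolding abs_mult by (intro summable_mult one_minus_powr_series s)
      show "(\<lambda>n. 2 powr s * one_minus_powr s $ n * t ^ n) sums polyharmonic_spline CARD('n) k (sqrt (2 - 2 * t))"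
        if "\<bar>t\<bar> \<le> 1" for t
        unfolding mult.assoc using that True m
        by (subst polyharmonic_spline_odd) (auto simp: s_def[symmetric] intro!: sums_mult one_minus_powr_series s)
      show "0 < (-1) ^ Suc m * (2 powr s * one_minus_powr s $ n)" if "n \<ge> Suc m" for n
        using one_minus_powr_sign[OF s_def that] by (simp add: mult.left_commute[of _ "2 powr s"] del: power_Suc)
      show "\<exists>c. c \<noteq> 0 \<and> (\<lambda>n. 2 powr s * one_minus_powr s $ n * gegenbauer_coeff CARD('n) l n) sums c"
        if "l < Suc m" for l
        using gegenbauer_coeff_sums_half_integer[OF d, of l m] that
        by (intro scale) (auto simp: s_def)
    qed
  next
    case False
    then have "even (2 * k - CARD('n))" by simp
    then obtain m where m: "2 * k - CARD('n) = 2 * m" by (rule evenE)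
    have m0: "m > 0" using m kd by (cases m) auto
    define C :: real where "C = 2 ^ m / 2"
    have C: "C > 0" by (simp add: C_def)
    show ?thesis
    proof (rule dense[where M = "Suc m" and \<sigma> = "(-1) ^ Suc m" and a = "\<lambda>n. C * log_power m $ n"])
      show "summable (\<lambda>n. \<bar>C * log_power m $ n\<bar>)"
        unfolding abs_mult using m0 by (intro summable_mult log_power_series) simp
      show "(\<lambda>n. C * log_power m $ n * t ^ n) sums polyharmonic_spline CARD('n) k (sqrt (2 - 2 * t))"
        if "\<bar>t\<bar> \<le> 1" for t
      proof -
        have "polyharmonic_spline CARD('n) k (sqrt (2 - 2 * t)) = C * ((1 - t) ^ m * ln (2 - 2 * t))"
          unfolding C_def using that False m m0 by (intro polyharmonic_spline_even) auto
        then show ?thesis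
          unfolding mult.assoc using that m0 by (simp only:) (intro sums_mult log_power_series, auto)
      qed
      show "0 < (-1) ^ Suc m * (C * log_power m $ n)" if "n \<ge> Suc m" for n
        using log_power_sign[OF that] C by (simp add: mult.left_commute[of _ C] del: power_Suc)
      show "\<exists>c. c \<noteq> 0 \<and> (\<lambda>n. C * log_power m $ n * gegenbauer_coeff CARD('n) l n) sums c"
        if "l < Suc m" for l
        using gegenbauer_coeff_sums_log[OF d, of l m] that m0 C by (intro scale) auto
    qed
  qed
qed

end
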